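(* Let $n_1,n_2,n_3,k_1,k_2,k_3$ be integers with $0\le k_3\le n_3$, $0\le k_2-k_3\le n_2$, $0\le k_1-k_2\le n_1$, and $n=n_1+n_2+n_3$. Let $$U=\begin{pmatrix} U_{11}&0&0\\0&U_{22}&0\\0&0&U_{33}\end{pmatrix}=\begin{pmatrix} (I\;0)&0&0\\0&(I\;0)&0\\0&0&(I\;0)\end{pmatrix},$$ with row blocks of sizes $k_1-k_2,\,k_2-k_3,\,k_3$ and column blocks of sizes $n_1,n_2,n_3$ (so $U_{11}=(I^{(k_1-k_2)}\;0)$ etc.), viewed as a subspace of $\mathbb{F}_q^n$ of type $(k_1,k_2,k_3)$, and let $G_U$ be its stabilizer in $GL_{n_1,n_2,n_3}(\mathbb{F}_q)$. Let $Q,P\in\mathcal{M}(k_1,k_2,k_3;n_1,n_2,n_3)$ have matrix representations $$Q=\begin{pmatrix} Q_{11}&Q_{12}&Q_{13}\\0&Q_{22}&Q_{23}\\0&0&Q_{33}\end{pmatrix},\qquad P=\begin{pmatrix} P_{11}&P_{12}&P_{13}\\0&P_{22}&P_{23}\\0&0&P_{33}\end{pmatrix}$$ with the same block sizes. Then $Q$ and $P$ lie in the same orbit of $G_U$ if and only if all of the following hold: $\dim(U_{ii}\cap Q_{ii})=\dim(U_{ii}\cap P_{ii})$ for $i=1,2,3$; $\dim(U\cap Q)=\dim(U\cap P)$; $$\dim\left(\begin{pmatrix}U_{11}&0\\0&U_{22}\end{pmatrix}\cap\begin{pmatrix}Q_{11}&Q_{12}\\0&Q_{22}\end{pmatrix}\right)=\dim\left(\begin{pmatrix}U_{11}&0\\0&U_{22}\end{pmatrix}\cap\begin{pmatrix}P_{11}&P_{12}\\0&P_{22}\end{pmatrix}\right);$$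 $$\dim\left(\begin{pmatrix}U_{22}&0\\0&U_{33}\end{pmatrix}\cap\begin{pmatrix}Q_{22}&Q_{23}\\0&Q_{33}\end{pmatrix}\right)=\dim\left(\begin{pmatrix}U_{22}&0\\0&U_{33}\end{pmatrix}\cap\begin{pmatrix}P_{22}&P_{23}\\0&P_{33}\end{pmatrix}\right).$$
   Context: $\mathbb{F}_q$ is the field with $q$ elements. A matrix of full row rank represents the subspace spanned by its rows; intersections and dimensions of matrices mean those of the corresponding row spaces (e.g. $U_{ii}\cap Q_{ii}$ is the intersection of the row spaces of $U_{ii}$ and $Q_{ii}$ in $\mathbb{F}_q^{n_i}$; the $2\times2$ block matrices span subspaces of $\mathbb{F}_q^{n_1+n_2}$ or $\mathbb{F}_q^{n_2+n_3}$). $GL_{n_1,n_2,n_3}(\mathbb{F}_q)$ is the group of nonsingular $n\times n$ matrices that are block upper triangular with respect to the partition $n=n_1+n_2+n_3$, acting on subspaces of $\mathbb{F}_q^n$ by $P\mapsto PT$. With $E_2$ the span of the last $n_2+n_3$ standard basis vectors and $E_3$ the span of the last $n_3$, a $k_1$-dimensional subspace $P$ is of type $(k_1,k_2,k_3)$ if $\dim(P\cap E_2)=k_2$ and $\dim(P\cap E_3)=k_3$; $\mathcal{M}(k_1,k_2,k_3;n_1,n_2,n_3)$ is the set of such subspaces. Every such subspace has a matrix representation of the displayed block upper triangular form with $\operatorname{rank}Q_{11}=k_1-k_2$, $\operatorname{rank}Q_{22}=k_2-k_3$, $\operatorname{rank}Q_{33}=k_3$. *)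

theory Defs
  imports "Jordan_Normal_Form.VS_Connect" "HOL-Algebra.Group_Action"
begin

text \<open>
  Row vectors in \<open>F\<^sup>n\<close> are elements of \<open>carrier_vec n\<close>, and a subspace is the set of its
  vectors. Matrix blocks may have zero rows or zero columns.
\<close>

abbreviation rowsp :: "nat \<Rightarrow> 'a::field mat \<Rightarrow> 'a vec set" where
  "rowsp n A \<equiv> vec_space.row_space n A"

abbreviation is_subspace :: "nat \<Rightarrow> 'a::field vec set \<Rightarrow> bool" where
  "is_subspace n W \<equiv> subspace class_ring W (module_vec TYPE('a) n)"

abbreviation subspace_dim :: "nat \<Rightarrow> 'a::field vec set \<Rightarrow> nat" where
  "subspace_dim n W \<equiv>
     vectorspace.dim (class_ring :: 'a ring) (module_vec TYPE('a) n\<lparr>carrier := W\<rparr>)"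

text \<open>Block upper triangular matrices, blocks listed row by row:
  \<open>(A B; 0 D)\<close> and \<open>(A B C; 0 D E; 0 0 F)\<close>.\<close>

definition block_ut2 :: "'a::zero mat \<Rightarrow> 'a mat \<Rightarrow> 'a mat \<Rightarrow> 'a mat" where
  "block_ut2 A B D = four_block_mat A B (0\<^sub>m (dim_row D) (dim_col A)) D"

definition block_ut3 ::
  "'a::zero mat \<Rightarrow> 'a mat \<Rightarrow> 'a mat \<Rightarrow> 'a mat \<Rightarrow> 'a mat \<Rightarrow> 'a mat \<Rightarrow> 'a mat" where
  "block_ut3 A B C D E F = block_ut2 (block_ut2 A B D) (C @\<^sub>r E) F"

definition block_diag2 :: "'a::zero mat \<Rightarrow> 'a mat \<Rightarrow> 'a mat" where
  "block_diag2 A D = block_ut2 A (0\<^sub>m (dim_row A) (dim_col D)) D"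

definition block_diag3 :: "'a::zero mat \<Rightarrow> 'a mat \<Rightarrow> 'a mat \<Rightarrow> 'a mat" where
  "block_diag3 A D F = block_diag2 (block_diag2 A D) F"

text \<open>The \<open>r \<times> m\<close> matrix \<open>(I 0)\<close>, meant for \<open>r \<le> m\<close>.\<close>

definition id_zero_mat :: "nat \<Rightarrow> nat \<Rightarrow> 'a::{zero,one} mat" where
  "id_zero_mat r m = mat r m (\<lambda>(i, j). if i = j then 1 else 0)"

text \<open>The span of the last \<open>m\<close> standard basis vectors of \<open>F\<^sup>n\<close>, meant for \<open>m \<le> n\<close>.\<close>

definition last_coords :: "nat \<Rightarrow> nat \<Rightarrow> 'a::field vec set" where
  "last_coords n m =
     LinearCombinations.module.span class_ring (module_vec TYPE('a) n) {unit_vec n i | i. n - m \<le> i \<and> i < n}"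

definition subspaces_of_type ::
  "nat \<Rightarrow> nat \<Rightarrow> nat \<Rightarrow> nat \<Rightarrow> nat \<Rightarrow> nat \<Rightarrow> 'a::field vec set set" where
  "subspaces_of_type k1 k2 k3 n1 n2 n3 =
     (let n = n1 + n2 + n3 in
       {W. is_subspace n W \<and> subspace_dim n W = k1 \<and>
           subspace_dim n (W \<inter> last_coords n (n2 + n3)) = k2 \<and>
           subspace_dim n (W \<inter> last_coords n n3) = k3})"

definition GL3 :: "nat \<Rightarrow> nat \<Rightarrow> nat \<Rightarrow> 'a::field mat monoid" where
  "GL3 n1 n2 n3 =
     \<lparr>carrier = {T. invertible_mat T \<and>
        (\<exists>T11 \<in> carrier_mat n1 n1. \<exists>T12 \<in> carrier_mat n1 n2. \<exists>T13 \<in> carrier_mat n1 n3.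
         \<exists>T22 \<in> carrier_mat n2 n2. \<exists>T23 \<in> carrier_mat n2 n3. \<exists>T33 \<in> carrier_mat n3 n3.
           T = block_ut3 T11 T12 T13 T22 T23 T33)},
      mult = (*), one = 1\<^sub>m (n1 + n2 + n3)\<rparr>"

text \<open>The right action \<open>W \<mapsto> W T\<close>; the row vector \<open>w T\<close> is \<open>T\<^sup>T *\<^sub>v w\<close>. Being a right action, it is
  not an instance of the (left) \<open>group_action\<close> locale, but \<open>orbit\<close> and \<open>stabilizer\<close>, which only
  depend on the maps \<open>W \<mapsto> W T\<close>, have their usual meaning.\<close>

definition right_act :: "'a::field mat \<Rightarrow> 'a vec set \<Rightarrow> 'a vec set" where
  "right_act T W = (\<lambda>w. T\<^sup>T *\<^sub>v w) ` W"

definition stabilizer_GL3 :: "nat \<Rightarrow> nat \<Rightarrow> nat \<Rightarrow> 'a::field vec set \<Rightarrow> 'a mat monoid" where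
  "stabilizer_GL3 n1 n2 n3 U =
     (GL3 n1 n2 n3)\<lparr>carrier := stabilizer (GL3 n1 n2 n3) right_act U\<rparr>"

end

theory Submission
  imports Defs "HOL-Library.Product_Plus" "HOL-Library.Cardinality" "HOL-Library.Function_Algebras"
begin

text \<open>
  A pair of subspaces \<open>U, Q\<close> of a space with a flag \<open>V \<supseteq> E\<^sub>2 \<supseteq> E\<^sub>3\<close> is a representation of a
  star-shaped quiver of type \<open>D\<^sub>5\<close>, so it is a direct sum of copies of 15 indecomposables: 12 lines and 3
  planes. The 15 multiplicities are determined by 15 dimensions: those of \<open>V, E\<^sub>2, E\<^sub>3\<close>, of the
  intersections of \<open>U\<close> and of \<open>Q\<close> with these, and the six of the theorem. Instead of the general
  theory, an indecomposable summand is split off explicitly, its kind being read off the dimensions,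
  and the complements are compared by induction. Over a finite field all dimensions can be
  replaced by cardinalities, which are multiplicative along the splitting.
\<close>

section \<open>Lattice terms\<close>

text \<open>The number 15 comes from the 20 positive roots of D5: the five that vanish at the centre
  V (three on the arm through E2 and E3, one each at U and Q) do not come from subspaces. A line has
  three positions in the flag and four relative to U and Q, which gives 12; three planes remain.
  They are the obstacle: in a plane where U, Q and a flag member are three distinct lines, all
  intersections vanish, and such a plane plus a line that meets only V has the same intersection
  dimensions as three separate lines. The plane shows up in a subquotient of the flag, where U and Q
  have a common image; this is why sums occur in the lattice terms. The intersections in V/E2, V/E3
  and E2/E3 are those of the (1,1) blocks, of the upper left 2 by 2 blocks and of the (2,2) blocks,
  while the other three dimensions of the theorem belong to the intersections of U and Q inside V,
  E2 and E3.

  Isomorphisms are total linear maps on one type, constrained only by the images of five subspaces,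
  so a complement is again a system in the same type and the induction needs no new spaces.\<close>

text \<open>The constructors stand for \<open>V, E\<^sub>2, E\<^sub>3, U, Q\<close>.\<close>

datatype node = NV | NE2 | NE3 | NU | NQ

datatype 'i lterm = Gen 'i | Meet "'i lterm" "'i lterm" | Join "'i lterm" "'i lterm"

primrec leval :: "('i \<Rightarrow> 'v::plus set) \<Rightarrow> 'i lterm \<Rightarrow> 'v set" where
  "leval S (Gen i) = S i"
| "leval S (Meet s t) = leval S s \<inter> leval S t"
| "leval S (Join s t) = {x + y | x y. x \<in> leval S s \<and> y \<in> leval S t}"

text \<open>Lattice terms are monotone in their generators, and additive maps respect sums. Only
  membership is claimed, not equality of images: for a map that is not injective, the intersection
  of two images can exceed the image of the intersection.\<close>

lemma leval_hom:
  assumes "\<And>x y. f (x + y) = f x + f y" "\<And>k x. x \<in> S k \<Longrightarrow> f x \<in> R k" "x \<in> leval S t"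
  shows "f x \<in> leval R t"
  using assms(3)
proof (induction t arbitrary: x)
  case (Join s t)
  then obtain a b where "x = a + b" "a \<in> leval S s" "b \<in> leval S t" by auto
  with Join.IH show ?case by (auto simp: assms(1))
qed (auto simp: assms(2))

lemma leval_closed:
  assumes "\<And>x y. x \<in> W \<Longrightarrow> y \<in> W \<Longrightarrow> x + y \<in> W" "\<And>k x. x \<in> S k \<Longrightarrow> x \<in> W" "x \<in> leval S t"
  shows "x \<in> W"
  using assms(3)
proof (induction t arbitrary: x)
  case (Join s t)
  then obtain a b where "x = a + b" "a \<in> leval S s" "b \<in> leval S t" by auto
  with Join.IH show ?case by (auto simp: assms(1))
qed (auto simp: assms(2))

locale flagged_space = vector_space scale
  for scale :: "'a::field \<Rightarrow> 'b::ab_group_add \<Rightarrow> 'b"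
begin

text \<open>The ambient space \<open>S NV\<close> is a member of the system rather than the whole
  type. Complements of summands are then systems of the same kind, and finiteness is asked of
  \<open>S NV\<close> only.\<close>

definition flagged_pair :: "(node \<Rightarrow> 'b set) \<Rightarrow> bool" where
  "flagged_pair S \<longleftrightarrow> finite (S NV) \<and> (\<forall>k. subspace (S k) \<and> S k \<subseteq> S NV) \<and> S NE3 \<subseteq> S NE2"

lemma leval_subspace:
  assumes "\<And>k. subspace (S k)"
  shows "subspace (leval S t)"
  by (induction t) (auto simp: assms subspace_inter subspace_sums)

lemma leval_subset:
  assumes "flagged_pair S"
  shows "leval S t \<subseteq> S NV"
proof
  fix x assume "x \<in> leval S t"
  then show "x \<in> S NV"
    by (rule leval_closed[rotated 2]) (use assms in \<open>auto simp: flagged_pair_def subspace_add\<close>)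
qed

lemma leval_card_pos:
  assumes "flagged_pair S"
  shows "finite (leval S t)" "card (leval S t) > 0"
proof -
  show fin: "finite (leval S t)"
    using finite_subset[OF leval_subset[OF assms]] assms by (simp add: flagged_pair_def)
  have "0 \<in> leval S t"
    using assms by (intro subspace_0 leval_subspace) (auto simp: flagged_pair_def)
  with fin show "card (leval S t) > 0" by (auto simp: card_gt_0_iff)
qed

section \<open>Linear forms with prescribed zeros\<close>

definition lin_form :: "('b \<Rightarrow> 'a) \<Rightarrow> bool" where
  "lin_form \<phi> \<longleftrightarrow> (\<forall>x y. \<phi> (x + y) = \<phi> x + \<phi> y) \<and> (\<forall>c x. \<phi> (scale c x) = c * \<phi> x)"

lemma lin_formD:
  assumes "lin_form \<phi>"
  shows "\<phi> (x + y) = \<phi> x + \<phi> y" "\<phi> (scale c x) = c * \<phi> x" "\<phi> (x - y) = \<phi> x - \<phi> y"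
    "\<phi> 0 = 0" "\<phi> (- x) = - \<phi> x"
proof -
  show 1: "\<phi> (x + y) = \<phi> x + \<phi> y" "\<phi> (scale c x) = c * \<phi> x" for x y c
    using assms by (auto simp: lin_form_def)
  show "\<phi> 0 = 0" using 1(2)[of 0 0] by simp
  show 2: "\<phi> (- x) = - \<phi> x" for x using 1(2)[of "-1" x] by (simp add: scale_minus_left)
  show "\<phi> (x - y) = \<phi> x - \<phi> y" using 1(1)[of x "-y"] 2 by simp
qed

text \<open>The form reads off the coordinate at \<open>w\<close> in a basis of the whole space that
  extends \<open>w\<close> together with a basis of \<open>A\<close>.\<close>

lemma lin_form_separating:
  assumes "subspace A" "w \<notin> A"
  obtains \<phi> where "lin_form \<phi>" "\<phi> w = 1" "\<And>x. x \<in> A \<Longrightarrow> \<phi> x = 0"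
proof -
  obtain B where B: "B \<subseteq> A" "independent B" "span B = A"
    by (metis assms(1) basis_exists span_subspace)
  with assms have wB: "independent (insert w B)" by (simp add: independent_insert)
  define D where "D = extend_basis (insert w B)"
  have D: "independent D" "span D = UNIV" "insert w B \<subseteq> D"
    using independent_extend_basis[OF wB] span_extend_basis[OF wB] extend_basis_superset[OF wB]
    by (auto simp: D_def)
  define \<phi> where "\<phi> x = representation D x w" for x
  show ?thesis
  proof
    show "lin_form \<phi>"
      unfolding lin_form_def \<phi>_def using D by (simp add: representation_add representation_scale)
    show "\<phi> w = 1" using D by (simp add: \<phi>_def representation_basis)
    show "\<phi> x = 0" if "x \<in> A" for x
    proof -
      have "representation D x = representation B x"
        using D B that by (intro representation_extend) auto
      moreover have "w \<notin> B" using B assms by auto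
      ultimately show ?thesis
        using representation_ne_zero by (auto simp: \<phi>_def)
    qed
  qed
qed

text \<open>Zero on \<open>A\<close> is glued to \<psi> on \<open>B\<close>. If \<psi> is not zero
  on \<open>B\<close>, take \<open>b\<close> in \<open>B\<close> with value 1 and let
  \<open>N\<close> be the kernel of \<psi> in \<open>B\<close>. Compatibility on the intersection
  keeps \<open>b\<close> out of A + N, and a form that kills A + N and is 1 at \<open>b\<close>
  agrees with \<psi> on \<open>B\<close>, since \<open>N\<close> and \<open>b\<close> span
  \<open>B\<close>.\<close>

lemma lin_form_extension:
  assumes "subspace A" "subspace B" "lin_form \<psi>" "\<And>x. x \<in> A \<inter> B \<Longrightarrow> \<psi> x = 0"
  obtains \<theta> where "lin_form \<theta>" "\<And>x. x \<in> A \<Longrightarrow> \<theta> x = 0" "\<And>x. x \<in> B \<Longrightarrow> \<theta> x = \<psi> x"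
proof (cases "\<forall>x\<in>B. \<psi> x = 0")
  case True
  then show ?thesis by (intro that[of "\<lambda>_. 0"]) (auto simp: lin_form_def)
next
  case False
  then obtain b0 where b0: "b0 \<in> B" "\<psi> b0 \<noteq> 0" by auto
  define b where "b = scale (inverse (\<psi> b0)) b0"
  have b: "b \<in> B" "\<psi> b = 1"
    using b0 assms by (auto simp: b_def lin_formD subspace_scale)
  define N where "N = B \<inter> {x. \<psi> x = 0}"
  have N: "subspace N"
    using assms(2,3) by (auto simp: N_def subspace_def lin_formD)
  have bn: "b \<notin> {x + y | x y. x \<in> A \<and> y \<in> N}"
  proof
    assume "b \<in> {x + y | x y. x \<in> A \<and> y \<in> N}"
    then obtain x y where xy: "b = x + y" "x \<in> A" "y \<in> N" by auto
    then have "x = b - y" by simp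
    moreover have "y \<in> B" "\<psi> y = 0" using xy by (auto simp: N_def)
    ultimately have "x \<in> B" "\<psi> x = 1"
      using b assms(2,3) by (simp_all add: subspace_diff lin_formD)
    with assms(4)[of x] xy(2) show False by simp
  qed
  then obtain \<theta> where \<theta>: "lin_form \<theta>" "\<theta> b = 1" "\<And>x. x \<in> {x + y | x y. x \<in> A \<and> y \<in> N} \<Longrightarrow> \<theta> x = 0"
    using lin_form_separating[OF subspace_sums[OF assms(1) N] bn] by blast
  have \<theta>A: "\<theta> x = 0" if "x \<in> A" for x
  proof -
    have "x + 0 \<in> {x + y | x y. x \<in> A \<and> y \<in> N}" using that subspace_0[OF N] by blast
    from \<theta>(3)[OF this] show ?thesis by simp
  qed
  have \<theta>N: "\<theta> x = 0" if "x \<in> N" for x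
  proof -
    have "0 + x \<in> {x + y | x y. x \<in> A \<and> y \<in> N}" using that subspace_0[OF assms(1)] by blast
    from \<theta>(3)[OF this] show ?thesis by simp
  qed
  have "\<theta> x = \<psi> x" if "x \<in> B" for x
  proof -
    have "x - scale (\<psi> x) b \<in> N"
      using that b assms(2,3) by (auto simp: N_def subspace_diff subspace_scale lin_formD)
    from \<theta>N[OF this] show ?thesis using \<theta>(1,2) by (simp add: lin_formD)
  qed
  with \<theta>(1) \<theta>A show ?thesis by (intro that)
qed

text \<open>The model \<open>C\<close> is a direct summand of \<open>S\<close>, with projection \<open>\<alpha>\<close> and inclusion \<open>\<beta>\<close>.\<close>

definition splits :: "(node \<Rightarrow> ('a \<times> 'a) set) \<Rightarrow> (node \<Rightarrow> 'b set) \<Rightarrow> ('b \<Rightarrow> 'a \<times> 'a) \<Rightarrow> ('a \<times> 'a \<Rightarrow> 'b) \<Rightarrow> bool"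
  where "splits C S \<alpha> \<beta> \<longleftrightarrow>
    (\<forall>x y. \<alpha> (x + y) = \<alpha> x + \<alpha> y) \<and> (\<forall>c x. \<alpha> (scale c x) = (c * fst (\<alpha> x), c * snd (\<alpha> x))) \<and>
    (\<forall>x y. \<beta> (x + y) = \<beta> x + \<beta> y) \<and> (\<forall>c z. \<beta> (c * fst z, c * snd z) = scale c (\<beta> z)) \<and>
    (\<forall>k. (\<forall>z\<in>C k. \<alpha> (\<beta> z) = z \<and> \<beta> z \<in> S k) \<and> (\<forall>x\<in>S k. \<alpha> x \<in> C k))"

lemma splitsD:
  assumes "splits C S \<alpha> \<beta>"
  shows "\<alpha> (x + y) = \<alpha> x + \<alpha> y" "\<alpha> (scale c x) = (c * fst (\<alpha> x), c * snd (\<alpha> x))"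
    "\<beta> (z + w) = \<beta> z + \<beta> w" "\<beta> (c * a, c * b) = scale c (\<beta> (a, b))"
    "z \<in> C k \<Longrightarrow> \<alpha> (\<beta> z) = z" "z \<in> C k \<Longrightarrow> \<beta> z \<in> S k" "x \<in> S k \<Longrightarrow> \<alpha> x \<in> C k"
    "\<alpha> (x - y) = \<alpha> x - \<alpha> y"
proof -
  have sp: "\<forall>x y. \<alpha> (x + y) = \<alpha> x + \<alpha> y"
    "\<forall>c x. \<alpha> (scale c x) = (c * fst (\<alpha> x), c * snd (\<alpha> x))"
    "\<forall>z w. \<beta> (z + w) = \<beta> z + \<beta> w"
    "\<forall>c z. \<beta> (c * fst z, c * snd z) = scale c (\<beta> z)"
    and mem: "\<forall>k. (\<forall>z\<in>C k. \<alpha> (\<beta> z) = z \<and> \<beta> z \<in> S k) \<and> (\<forall>x\<in>S k. \<alpha> x \<in> C k)"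
    using assms by (simp_all add: splits_def del: split_paired_All)
  show "\<alpha> (x + y) = \<alpha> x + \<alpha> y" "\<alpha> (scale c x) = (c * fst (\<alpha> x), c * snd (\<alpha> x))"
    "\<beta> (z + w) = \<beta> z + \<beta> w"
    by (rule sp[rule_format])+
  show "\<beta> (c * a, c * b) = scale c (\<beta> (a, b))"
    using sp(4)[rule_format, of c "(a, b)"] by simp
  show "\<alpha> (x - y) = \<alpha> x - \<alpha> y"
    using sp(1)[rule_format, of "x - y" y] by simp
  show "z \<in> C k \<Longrightarrow> \<alpha> (\<beta> z) = z" "z \<in> C k \<Longrightarrow> \<beta> z \<in> S k" "x \<in> S k \<Longrightarrow> \<alpha> x \<in> C k"
    using mem by blast+
qed

text \<open>A single kernel cuts all five members, so the decomposition into summand and complement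
  is compatible with the whole system.\<close>

definition complement :: "(node \<Rightarrow> 'b set) \<Rightarrow> ('b \<Rightarrow> 'a \<times> 'a) \<Rightarrow> node \<Rightarrow> 'b set" where
  "complement S \<alpha> k = S k \<inter> {x. \<alpha> x = 0}"

lemma complement_residue:
  assumes "splits C S \<alpha> \<beta>" "\<And>k. subspace (S k)" "x \<in> S k"
  shows "x - \<beta> (\<alpha> x) \<in> complement S \<alpha> k"
proof -
  have "\<alpha> x \<in> C k" using assms(1,3) by (rule splitsD)
  note this splitsD(5,6)[OF assms(1) this]
  with assms show ?thesis by (simp add: complement_def splitsD(8) subspace_diff)
qed

lemma complement_flagged_pair:
  assumes "splits C S \<alpha> \<beta>" "flagged_pair S"
  shows "flagged_pair (complement S \<alpha>)"
proof -
  have "\<alpha> 0 = 0" using splitsD(8)[OF assms(1), of 0 0] by simp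
  then have "subspace {x. \<alpha> x = 0}"
    using splitsD(1,2)[OF assms(1)] by (auto simp: subspace_def zero_prod_def)
  with assms(2) show ?thesis
    by (auto simp: flagged_pair_def complement_def subspace_inter)
qed

text \<open>Four additive maps respect the generators: \<beta>, \<alpha>, the inclusion of the
  complement, and the residue map \<open>x - \<beta> (\<alpha> x)\<close>. By
  \<open>leval_hom\<close> they respect every term, so the decomposition passes through meets and
  joins, and adding the two components is a bijection for each term.\<close>

lemma splits_card:
  assumes sp: "splits C S \<alpha> \<beta>" and S: "flagged_pair S"
  shows "card (leval S t) = card (leval C t) * card (leval (complement S \<alpha>) t)"
proof -
  note D = splitsD[OF sp]
  let ?K = "complement S \<alpha>"
  have subS: "subspace (S k)" for k using S by (simp add: flagged_pair_def)
  have C_fix: "\<alpha> (\<beta> z) = z" if "z \<in> leval C t" for z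
    using leval_closed[where W = "{z. \<alpha> (\<beta> z) = z}" and S = C, OF _ _ that] D(5)
    by (simp add: D(1,3))
  have \<beta>C: "\<beta> z \<in> leval S t" if "z \<in> leval C t" for z
    by (rule leval_hom[OF D(3) D(6) that])
  have \<alpha>S: "\<alpha> x \<in> leval C t" if "x \<in> leval S t" for x
    by (rule leval_hom[OF D(1) D(7) that])
  have K0: "\<alpha> x = 0" if "x \<in> leval ?K t" for x
    using leval_closed[where W = "{x. \<alpha> x = 0}" and S = ?K, OF _ _ that] by (simp add: D(1) complement_def)
  have KS: "x \<in> leval S t" if "x \<in> leval ?K t" for x
    using leval_hom[where f = "\<lambda>x. x" and S = ?K and R = S, OF _ _ that] by (simp add: complement_def)
  have SK: "x - \<beta> (\<alpha> x) \<in> leval ?K t" if "x \<in> leval S t" for x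
    using leval_hom[where f = "\<lambda>x. x - \<beta> (\<alpha> x)" and S = S and R = ?K, OF _ _ that]
    by (simp add: D(1,3) complement_residue[OF sp subS])
  have add: "x + y \<in> leval S t" if "x \<in> leval S t" "y \<in> leval S t" for x y
    using that leval_subspace[of S t] subS by (simp add: subspace_add)
  have "bij_betw (\<lambda>(z, h). \<beta> z + h) (leval C t \<times> leval ?K t) (leval S t)"
    by (rule bij_betw_byWitness[where f' = "\<lambda>x. (\<alpha> x, x - \<beta> (\<alpha> x))"])
      (auto simp: D(1,3,8) C_fix \<beta>C \<alpha>S K0 KS SK add)
  from bij_betw_same_card[OF this] show ?thesis by (simp add: card_cartesian_product)
qed

text \<open>The map carries the summand across by \<beta>' after \<alpha> and the residue by
  \<open>h\<close>. It is onto because \<open>y\<close> is the sum of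
  \<open>\<beta>' (\<alpha>' y)\<close> and an element of the second complement; a preimage of the
  latter under \<open>h\<close> is added to \<open>\<beta> (\<alpha>' y)\<close>.\<close>

lemma iso_extend_summand:
  assumes sp: "splits C S \<alpha> \<beta>" and sp': "splits C S' \<alpha>' \<beta>'"
    and S: "flagged_pair S" and S': "flagged_pair S'"
    and lin: "\<And>x y. h (x + y) = h x + h y" "\<And>c x. h (scale c x) = scale c (h x)"
    and h: "\<And>k. h ` complement S \<alpha> k = complement S' \<alpha>' k"
  obtains f where "\<And>x y. f (x + y) = f x + f y" "\<And>c x. f (scale c x) = scale c (f x)"
    "\<And>k. f ` S k = S' k"
proof
  note D = splitsD[OF sp] and D' = splitsD[OF sp']
  have sub: "subspace (S k)" "subspace (S' k)" for k
    using S S' by (auto simp: flagged_pair_def)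
  define f where "f x = \<beta>' (\<alpha> x) + h (x - \<beta> (\<alpha> x))" for x
  have hdiff: "h (x - y) = h x - h y" for x y
    using lin(1)[of "x - y" y] by simp
  show "f (x + y) = f x + f y" for x y
    by (simp add: f_def D(1,3) D'(1,3) lin(1) hdiff)
  show "f (scale c x) = scale c (f x)" for c x
    by (simp add: f_def D(2,4) D'(2,4) lin hdiff scale_right_distrib scale_right_diff_distrib)
  have "f x \<in> S' k" if "x \<in> S k" for x k
  proof -
    have "h (x - \<beta> (\<alpha> x)) \<in> complement S' \<alpha>' k"
      using complement_residue[OF sp sub(1) that] h by blast
    moreover have "\<beta>' (\<alpha> x) \<in> S' k" using D(7)[OF that] by (rule D')
    ultimately show ?thesis by (simp add: f_def complement_def subspace_add sub)
  qed
  moreover have "y \<in> f ` S k" if y: "y \<in> S' k" for y k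
  proof -
    have "y - \<beta>' (\<alpha>' y) \<in> h ` complement S \<alpha> k"
      using complement_residue[OF sp' sub(2) y] h by blast
    then obtain x where x: "x \<in> S k" "\<alpha> x = 0" "h x = y - \<beta>' (\<alpha>' y)"
      by (auto simp: complement_def)
    have "\<alpha>' y \<in> C k" using y by (rule D')
    note D(5,6)[OF this]
    then have "\<beta> (\<alpha>' y) + x \<in> S k" "\<alpha> (\<beta> (\<alpha>' y) + x) = \<alpha>' y"
      using x by (simp_all add: D(1) subspace_add sub)
    moreover from this have "f (\<beta> (\<alpha>' y) + x) = y" using x by (simp add: f_def)
    ultimately show ?thesis by (metis imageI)
  qed
  ultimately show "f ` S k = S' k" for k by blast
qed

end

section \<open>Models of the indecomposable summands\<close>

text \<open>
  All models live in the plane. A line, contained in exactly the members of \<open>\<tau>\<close>, is the first axis. In a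
  plane summand, \<open>U\<close> and \<open>Q\<close> are the two axes, \<open>F\<close> lists the flag members containing the plane, and
  \<open>M\<close> those meeting it in the diagonal.
\<close>

definition line_model :: "node set \<Rightarrow> node \<Rightarrow> ('a::field \<times> 'a) set" where
  "line_model \<tau> k = {z. snd z = 0 \<and> (k \<notin> \<tau> \<longrightarrow> fst z = 0)}"

definition plane_model :: "node set \<Rightarrow> node set \<Rightarrow> node \<Rightarrow> ('a::field \<times> 'a) set" where
  "plane_model F M k =
    (case k of NU \<Rightarrow> {z. snd z = 0} | NQ \<Rightarrow> {z. fst z = 0}
     | _ \<Rightarrow> if k \<in> F then UNIV else if k \<in> M then {z. fst z = snd z} else {0})"

text \<open>The indices name a subquotient of the flag, counting V as the first member. Modulo E2,
  \<open>meet12\<close> is the intersection of the images of U and Q in V/E2; modulo E3,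
  \<open>meet13\<close> is the one in V/E3, and \<open>meet23\<close> is that of U \<inter> E2 and Q
  \<inter> E2 in E2/E3.\<close>

definition meet12 :: "node lterm" where
  "meet12 = Meet (Join (Gen NU) (Gen NE2)) (Join (Gen NQ) (Gen NE2))"

definition meet13 :: "node lterm" where
  "meet13 = Meet (Join (Gen NU) (Gen NE3)) (Join (Gen NQ) (Gen NE3))"

definition meet23 :: "node lterm" where
  "meet23 = Meet (Join (Meet (Gen NU) (Gen NE2)) (Gen NE3)) (Join (Meet (Gen NQ) (Gen NE2)) (Gen NE3))"

definition invariant_terms :: "node lterm set" where
  "invariant_terms = {Gen NV, Gen NE2, Gen NE3,
    Gen NU, Meet (Gen NU) (Gen NE2), Meet (Gen NU) (Gen NE3),
    Gen NQ, Meet (Gen NQ) (Gen NE2), Meet (Gen NQ) (Gen NE3),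
    Meet (Gen NU) (Gen NQ), Meet (Meet (Gen NU) (Gen NQ)) (Gen NE2),
    Meet (Meet (Gen NU) (Gen NQ)) (Gen NE3), meet12, meet13, meet23}"

text \<open>
  The kind of the summand to be split off. The order matters: a test detects its summand only
  because the multiplicities tested before it are zero.
\<close>

definition summand_model :: "(node lterm \<Rightarrow> nat) \<Rightarrow> node \<Rightarrow> ('a::field \<times> 'a) set" where
  "summand_model N =
    (if N (Meet (Meet (Gen NU) (Gen NQ)) (Gen NE3)) \<noteq> 1 then line_model UNIV
     else if N (Meet (Meet (Gen NU) (Gen NQ)) (Gen NE2)) \<noteq> 1 then line_model (- {NE3})
     else if N (Meet (Gen NU) (Gen NQ)) \<noteq> 1 then line_model (- {NE2, NE3})
     else if N meet23 \<noteq> N (Gen NE3) then plane_model {NV, NE2} {NE3}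
     else if N meet13 \<noteq> N (Gen NE3) then plane_model {NV} {NE2, NE3}
     else if N meet12 \<noteq> N (Gen NE2) then plane_model {NV} {NE2}
     else if N (Meet (Gen NU) (Gen NE3)) \<noteq> 1 then line_model (- {NQ})
     else if N (Meet (Gen NU) (Gen NE2)) \<noteq> 1 then line_model {NV, NE2, NU}
     else if N (Gen NU) \<noteq> 1 then line_model {NV, NU}
     else if N (Meet (Gen NQ) (Gen NE3)) \<noteq> 1 then line_model (- {NU})
     else if N (Meet (Gen NQ) (Gen NE2)) \<noteq> 1 then line_model {NV, NE2, NQ}
     else if N (Gen NQ) \<noteq> 1 then line_model {NV, NQ}
     else if N (Gen NE3) \<noteq> 1 then line_model {NV, NE2, NE3}
     else if N (Gen NE2) \<noteq> 1 then line_model {NV, NE2}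
     else line_model {NV})"

text \<open>Two systems with equal invariants split off the very same model, so that its
  contribution can be cancelled on both sides.\<close>

lemma summand_model_cong:
  assumes "\<And>t. t \<in> invariant_terms \<Longrightarrow> N t = N' t"
  shows "summand_model N = summand_model N'"
proof -
  have "\<forall>t\<in>invariant_terms. N t = N' t" using assms by blast
  then show ?thesis by (simp add: invariant_terms_def summand_model_def)
qed

text \<open>Ensures that splitting off a model makes the ambient space strictly smaller.\<close>

lemma summand_model_nontrivial: "(1, 0) \<in> summand_model N NV"
  by (simp add: summand_model_def line_model_def plane_model_def)

section \<open>Criteria for a line or a plane to split off\<close>

context flagged_space
begin

text \<open>The inclusion scales \<open>w\<close>; the projection is a form that is 1 at
  \<open>w\<close> and kills \<open>A\<close>, hence every member outside \<tau>. Members in \<tau>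
  contain the line, so any value of the form is allowed on them.\<close>

lemma splits_line:
  assumes "subspace A" "w \<notin> A" "\<And>k. k \<in> \<tau> \<Longrightarrow> w \<in> S k" "\<And>k. k \<notin> \<tau> \<Longrightarrow> S k \<subseteq> A"
    and S: "flagged_pair S"
  shows "\<exists>\<alpha> \<beta>. splits (line_model \<tau>) S \<alpha> \<beta>"
proof -
  obtain \<phi> where \<phi>: "lin_form \<phi>" "\<phi> w = 1" "\<And>x. x \<in> A \<Longrightarrow> \<phi> x = 0"
    using lin_form_separating[OF assms(1,2)] by blast
  have sub: "subspace (S k)" for k
    using S by (simp add: flagged_pair_def)
  have zero: "\<phi> x = 0" if "x \<in> S k" "k \<notin> \<tau>" for x k
    using that assms(4) \<phi>(3) by blast
  have "scale a w \<in> S k" if "k \<notin> \<tau> \<longrightarrow> a = 0" for a k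
    using that assms(3) sub by (cases "k \<in> \<tau>") (auto simp: subspace_scale subspace_0)
  then have "splits (line_model \<tau>) S (\<lambda>x. (\<phi> x, 0)) (\<lambda>z. scale (fst z) w)"
    using zero \<phi>(2)
    by (auto simp: splits_def line_model_def lin_formD[OF \<phi>(1)] scale_left_distrib)
  then show ?thesis by blast
qed

text \<open>The plane is spanned by \<open>u\<close> and \<open>q\<close>, and the projection is a
  pair of forms \<theta>, \<psi>. The model dictates that \<theta> kills Q, that \<psi> kills U,
  that both agree on \<open>E\<close>, where the members meeting the plane in the diagonal lie, and
  that both kill the members missing the plane, which lie in \<open>Z\<close> and \<open>E\<close>.
  So \<psi> has to kill U, \<open>Z\<close> and the part of Q in \<open>E\<close>, where it equals
  \<theta>; \<open>notin\<close> says that this leaves \<open>u - q\<close> free to get the value 1.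
  Then \<theta> is glued from 0 on Q and \<psi> on \<open>E\<close>.\<close>

lemma splits_plane:
  assumes S: "flagged_pair S" and uq: "u \<in> S NU" "q \<in> S NQ"
    and "subspace E" "subspace Z" "u - q \<in> E"
    and notin: "\<And>a z b. a \<in> S NU \<Longrightarrow> z \<in> Z \<Longrightarrow> b \<in> S NQ \<Longrightarrow> b \<in> E \<Longrightarrow> u - q \<noteq> a + z + b"
    and flag: "\<And>k. k \<noteq> NU \<Longrightarrow> k \<noteq> NQ \<Longrightarrow> (k \<in> F \<and> u \<in> S k \<and> q \<in> S k) \<or>
      (k \<notin> F \<and> k \<in> M \<and> u - q \<in> S k \<and> S k \<subseteq> E) \<or> (k \<notin> F \<and> k \<notin> M \<and> S k \<subseteq> Z \<and> S k \<subseteq> E)"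
  shows "\<exists>\<alpha> \<beta>. splits (plane_model F M) S \<alpha> \<beta>"
proof -
  have sub: "subspace (S k)" for k
    using S by (simp add: flagged_pair_def)
  let ?A = "{x + y | x y. x \<in> {x + y | x y. x \<in> S NU \<and> y \<in> Z} \<and> y \<in> S NQ \<inter> E}"
  have "subspace ?A"
    by (intro subspace_sums subspace_inter sub assms)
  moreover have "u - q \<notin> ?A"
  proof
    assume "u - q \<in> ?A"
    then obtain a z b where "u - q = (a + z) + b" "a \<in> S NU" "z \<in> Z" "b \<in> S NQ" "b \<in> E"
      by blast
    with notin[of a z b] show False by simp
  qed
  ultimately obtain \<psi> where \<psi>: "lin_form \<psi>" "\<psi> (u - q) = 1" "\<And>x. x \<in> ?A \<Longrightarrow> \<psi> x = 0"
    by (rule lin_form_separating) (rule that)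
  note \<psi>l = lin_formD[OF \<psi>(1)]
  have \<psi>0: "\<psi> a + \<psi> z + \<psi> b = 0" if "a \<in> S NU" "z \<in> Z" "b \<in> S NQ" "b \<in> E" for a z b
  proof -
    have "a + z + b \<in> ?A" using that by blast
    from \<psi>(3)[OF this] show ?thesis by (simp add: \<psi>l)
  qed
  note z = subspace_0[OF sub] subspace_0[OF assms(4)] subspace_0[OF assms(5)]
  have \<psi>U: "\<psi> x = 0" if "x \<in> S NU" for x
    using \<psi>0[OF that z(3) z(1) z(2)] by (simp add: \<psi>l)
  have \<psi>Z: "\<psi> x = 0" if "x \<in> Z" for x
    using \<psi>0[OF z(1) that z(1) z(2)] by (simp add: \<psi>l)
  have \<psi>Q: "\<psi> x = 0" if "x \<in> S NQ \<inter> E" for x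
    using \<psi>0[OF z(1) z(3), of x] that by (simp add: \<psi>l)
  obtain \<theta> where \<theta>: "lin_form \<theta>" "\<And>x. x \<in> S NQ \<Longrightarrow> \<theta> x = 0" "\<And>x. x \<in> E \<Longrightarrow> \<theta> x = \<psi> x"
    using lin_form_extension[OF sub assms(4) \<psi>(1) \<psi>Q] by blast
  note \<theta>l = lin_formD[OF \<theta>(1)]
  have vals: "\<psi> u = 0" "\<psi> q = - 1" "\<theta> q = 0" "\<theta> u = 1"
  proof -
    show 1: "\<psi> u = 0" "\<theta> q = 0" using \<psi>U uq \<theta>(2) by auto
    have "- \<psi> q = 1" using \<psi>(2) 1 by (simp add: \<psi>l)
    then have "- (- \<psi> q) = - 1" by (rule arg_cong)
    then show "\<psi> q = - 1" by simp
    show "\<theta> u = 1" using \<theta>(3)[OF assms(6)] \<psi>(2) 1 by (simp add: \<theta>l)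
  qed
  define \<alpha> where "\<alpha> x = (\<theta> x, \<psi> x)" for x
  \<comment> \<open>The minus sign sends the diagonal vector (1, 1) to \<open>u - q\<close> and
    offsets the value -1 of \<psi> at \<open>q\<close>.\<close>
  define \<beta> where "\<beta> z = scale (fst z) u - scale (snd z) q" for z
  have \<alpha>\<beta>: "\<alpha> (\<beta> z) = z" for z
    by (simp add: \<alpha>_def \<beta>_def \<theta>l \<psi>l vals)
  have mem: "(\<forall>z\<in>plane_model F M k. \<beta> z \<in> S k) \<and> (\<forall>x\<in>S k. \<alpha> x \<in> plane_model F M k)" for k
  proof -
    consider "k = NU" | "k = NQ" | "k \<noteq> NU" "k \<noteq> NQ" by blast
    then show ?thesis
    proof cases
      case 1
      then show ?thesis using subspace_scale[OF sub uq(1)] \<psi>U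
        by (simp add: plane_model_def \<alpha>_def \<beta>_def del: split_paired_All)
    next
      case 2
      then show ?thesis using subspace_neg[OF sub subspace_scale[OF sub uq(2)]] \<theta>(2)
        by (simp add: plane_model_def \<alpha>_def \<beta>_def del: split_paired_All)
    next
      case False: 3
      then have pm: "plane_model F M k = (if k \<in> F then UNIV else if k \<in> M then {z. fst z = snd z} else {0})"
        by (cases k) (simp_all add: plane_model_def)
      have diag: "\<beta> z = scale (fst z) (u - q)" if "fst z = snd z" for z
        using that by (simp add: \<beta>_def scale_right_diff_distrib)
      from flag[OF False] consider "k \<in> F" "u \<in> S k" "q \<in> S k"
        | "k \<notin> F" "k \<in> M" "u - q \<in> S k" "S k \<subseteq> E"
        | "k \<notin> F" "k \<notin> M" "S k \<subseteq> Z" "S k \<subseteq> E" by blast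
      then show ?thesis
      proof cases
        case 1
        then show ?thesis using sub by (simp add: pm \<beta>_def subspace_diff subspace_scale)
      next
        case 2
        then have "\<theta> x = \<psi> x" if "x \<in> S k" for x using that \<theta>(3) by blast
        with 2 sub show ?thesis by (simp add: pm diag \<alpha>_def subspace_scale)
      next
        case 3
        have "\<theta> x = 0" "\<psi> x = 0" if "x \<in> S k" for x
        proof -
          have "x \<in> Z" "x \<in> E" using that 3(3,4) by auto
          then show "\<psi> x = 0" "\<theta> x = 0" using \<theta>(3) \<psi>Z by auto
        qed
        with 3 z(1) show ?thesis by (simp add: pm \<alpha>_def \<beta>_def zero_prod_def)
      qed
    qed
  qed
  have "splits (plane_model F M) S \<alpha> \<beta>"
    unfolding splits_def using mem
    by (simp add: \<alpha>\<beta> del: split_paired_All)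
      (simp add: \<alpha>_def \<beta>_def \<theta>l \<psi>l scale_left_distrib scale_right_diff_distrib)
  then show ?thesis by blast
qed

lemma subspace_card_1:
  assumes "subspace A"
  shows "card A = 1 \<longleftrightarrow> A = {0}"
  using subspace_0[OF assms] by (auto simp: card_1_singleton_iff)

lemma subspace_nonzero:
  assumes "subspace A" "card A \<noteq> 1"
  obtains w where "w \<in> A" "w \<noteq> 0"
proof -
  have "A \<noteq> {0}" "0 \<in> A" using assms subspace_card_1 subspace_0 by auto
  then show ?thesis using that by auto
qed

section \<open>Classification of pairs of subspaces in a flagged space\<close>

text \<open>A vector, or a pair \<open>u\<close>, \<open>q\<close>, witnessing the first failing
  test spans the summand; the tests passed before it supply the independence required by
  \<open>splits_line\<close> or \<open>splits_plane\<close>. Comparison with 1 asks whether a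
  subspace is nonzero. A meet of sums is compared with the flag member that it contains, so
  inequality means a nonzero intersection in the subquotient.\<close>

lemma splits_summand_model:
  assumes S: "flagged_pair S" and nontriv: "card (S NV) \<noteq> 1"
  shows "\<exists>\<alpha> \<beta>. splits (summand_model (\<lambda>t. card (leval S t))) S \<alpha> \<beta>"
proof -
  define N where "N t = card (leval S t)" for t
  define U Q E F where "U = S NU" and "Q = S NQ" and "E = S NE2" and "F = S NE3"
  note set_defs = U_def Q_def E_def F_def
  have sub: "subspace (S k)" for k using S by (simp add: flagged_pair_def)
  have sub': "subspace U" "subspace Q" "subspace E" "subspace F" by (simp_all add: set_defs sub)
  have FE: "F \<subseteq> E" and inV: "S k \<subseteq> S NV" for k
    using S by (auto simp: set_defs flagged_pair_def)
  have z: "0 \<in> U" "0 \<in> Q" "0 \<in> E" "0 \<in> F" by (simp_all add: sub' subspace_0)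
  have trivial: "leval S t = {0}" if "N t = 1" for t
    using that subspace_card_1[OF leval_subspace[of S t]] sub by (simp add: N_def)
  have nonzero: "\<exists>w. w \<in> leval S t \<and> w \<noteq> 0" if "N t \<noteq> 1" for t
    using that subspace_nonzero[OF leval_subspace[of S t]] sub unfolding N_def by blast
  have coincide: "leval S t = S k" if "N t = N (Gen k)" "S k \<subseteq> leval S t" for t k
    using card_subset_eq[OF leval_card_pos(1)[OF S] that(2)] that(1) by (simp add: N_def)
  have proper: "\<exists>x. x \<in> leval S t \<and> x \<notin> S k" if "N t \<noteq> N (Gen k)" "S k \<subseteq> leval S t" for t k
  proof -
    have "leval S t \<noteq> S k" using that(1) by (auto simp: N_def)
    with that(2) show ?thesis by blast
  qed
  have m12: "leval S meet12 = {x + y | x y. x \<in> U \<and> y \<in> E} \<inter> {x + y | x y. x \<in> Q \<and> y \<in> E}"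
    and m13: "leval S meet13 = {x + y | x y. x \<in> U \<and> y \<in> F} \<inter> {x + y | x y. x \<in> Q \<and> y \<in> F}"
    and m23: "leval S meet23 =
      {x + y | x y. x \<in> U \<inter> E \<and> y \<in> F} \<inter> {x + y | x y. x \<in> Q \<inter> E \<and> y \<in> F}"
    by (simp_all add: meet12_def meet13_def meet23_def set_defs)
  have sum_right: "A \<subseteq> {x + y | x y. x \<in> B \<and> y \<in> A}" if "0 \<in> B" for A B :: "'b set"
  proof
    fix x assume "x \<in> A"
    then have "0 + x \<in> {x + y | x y. x \<in> B \<and> y \<in> A}" using that by blast
    then show "x \<in> {x + y | x y. x \<in> B \<and> y \<in> A}" by simp
  qed
  have le: "S NE2 \<subseteq> leval S meet12" "S NE3 \<subseteq> leval S meet13" "S NE3 \<subseteq> leval S meet23"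
    unfolding m12 m13 m23 E_def[symmetric] F_def[symmetric]
    by (intro Int_greatest sum_right; simp add: z)+
  let ?UQ3 = "Meet (Meet (Gen NU) (Gen NQ)) (Gen NE3)" and ?UQ2 = "Meet (Meet (Gen NU) (Gen NQ)) (Gen NE2)"
    and ?UQ = "Meet (Gen NU) (Gen NQ)"
    and ?U3 = "Meet (Gen NU) (Gen NE3)" and ?U2 = "Meet (Gen NU) (Gen NE2)"
    and ?Q3 = "Meet (Gen NQ) (Gen NE3)" and ?Q2 = "Meet (Gen NQ) (Gen NE2)"
  note line = splits_line[OF _ _ _ _ S]
  have zero_sub: "{0} \<subseteq> U" "{0} \<subseteq> Q" "{0} \<subseteq> E" "{0} \<subseteq> F" using z by auto
  consider
      "N ?UQ3 \<noteq> 1"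
    | "N ?UQ3 = 1" "N ?UQ2 \<noteq> 1"
    | "N ?UQ3 = 1" "N ?UQ2 = 1" "N ?UQ \<noteq> 1"
    | "N ?UQ3 = 1" "N ?UQ2 = 1" "N ?UQ = 1" "N meet23 \<noteq> N (Gen NE3)"
    | "N ?UQ3 = 1" "N ?UQ2 = 1" "N ?UQ = 1" "N meet23 = N (Gen NE3)" "N meet13 \<noteq> N (Gen NE3)"
    | "N ?UQ3 = 1" "N ?UQ2 = 1" "N ?UQ = 1" "N meet23 = N (Gen NE3)" "N meet13 = N (Gen NE3)"
      "N meet12 \<noteq> N (Gen NE2)"
    | "N ?UQ3 = 1" "N ?UQ2 = 1" "N ?UQ = 1" "N meet23 = N (Gen NE3)" "N meet13 = N (Gen NE3)"
      "N meet12 = N (Gen NE2)" "N ?U3 \<noteq> 1 \<or> N ?U2 \<noteq> 1 \<or> N (Gen NU) \<noteq> 1"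
    | "N ?UQ3 = 1" "N ?UQ2 = 1" "N ?UQ = 1" "N meet23 = N (Gen NE3)" "N meet13 = N (Gen NE3)"
      "N meet12 = N (Gen NE2)" "N ?U3 = 1" "N ?U2 = 1" "N (Gen NU) = 1"
    by blast
  then have "\<exists>\<alpha> \<beta>. splits (summand_model N) S \<alpha> \<beta>"
  proof cases
    case 1
    from nonzero[OF 1] obtain w where w: "w \<in> U" "w \<in> Q" "w \<in> F" "w \<noteq> 0" by (auto simp: set_defs)
    have "\<exists>\<alpha> \<beta>. splits (line_model UNIV) S \<alpha> \<beta>"
    proof (rule line[of "{0}" w])
      show "w \<in> S k" for k using w FE inV[of NU] by (cases k) (auto simp: set_defs)
    qed (use w in auto)
    with 1 show ?thesis by (simp add: summand_model_def)
  next
    case 2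
    from nonzero[OF 2(2)] obtain w where w: "w \<in> U" "w \<in> Q" "w \<in> E" "w \<noteq> 0" by (auto simp: set_defs)
    have "\<exists>\<alpha> \<beta>. splits (line_model (- {NE3})) S \<alpha> \<beta>"
    proof (rule line[of F w])
      show "w \<notin> F" using trivial[OF 2(1)] w by (auto simp: set_defs)
      show "w \<in> S k" if "k \<in> - {NE3}" for k
        using that w inV[of NU] by (cases k) (auto simp: set_defs)
    qed (use sub' in \<open>auto simp: set_defs\<close>)
    with 2 show ?thesis by (simp add: summand_model_def)
  next
    case 3
    from nonzero[OF 3(3)] obtain w where w: "w \<in> U" "w \<in> Q" "w \<noteq> 0" by (auto simp: set_defs)
    have "\<exists>\<alpha> \<beta>. splits (line_model (- {NE2, NE3})) S \<alpha> \<beta>"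
    proof (rule line[of E w])
      show "w \<notin> E" using trivial[OF 3(2)] w by (auto simp: set_defs)
      show "w \<in> S k" if "k \<in> - {NE2, NE3}" for k
        using that w inV[of NU] by (cases k) (auto simp: set_defs)
    qed (use sub' FE in \<open>auto simp: set_defs\<close>)
    with 3 show ?thesis by (simp add: summand_model_def)
  next
    case 4
    have UQ: "x = 0" if "x \<in> U" "x \<in> Q" for x
      using trivial[OF 4(3)] that by (auto simp: set_defs)
    obtain x where x: "x \<in> leval S meet23" "x \<notin> F" using proper[OF 4(4) le(3)] by (auto simp: F_def)
    then obtain u e q e' where u: "x = u + e" "u \<in> U" "u \<in> E" "e \<in> F"
      and q: "x = q + e'" "q \<in> Q" "q \<in> E" "e' \<in> F" unfolding m23 by blast
    have "u - q = e' - e" using u(1) q(1) by (simp add: algebra_simps)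
    then have uqF: "u - q \<in> F" using u q sub' by (simp add: subspace_diff)
    have uF: "u \<notin> F" using x(2) u sub' by (auto simp: subspace_add)
    \<comment> \<open>Only E3 meets the plane in the diagonal, and no flag member misses the plane,
      so E3 and zero are the two auxiliary subspaces. Since U and Q meet in zero, a dependence would
      force \<open>q\<close> into E3, and \<open>u\<close> with it.\<close>
    have "\<exists>\<alpha> \<beta>. splits (plane_model {NV, NE2} {NE3}) S \<alpha> \<beta>"
    proof (rule splits_plane[OF S, of u q F "{0}"])
      fix a z b :: 'b assume *: "a \<in> S NU" "z \<in> {0}" "b \<in> S NQ" "b \<in> F"
      show "u - q \<noteq> a + z + b"
      proof
        assume "u - q = a + z + b"
        then have "u - a = q + b" using * by (simp add: algebra_simps)
        moreover have "u - a \<in> U" "q + b \<in> Q"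
          using * u q sub' by (simp_all add: set_defs subspace_add subspace_diff)
        ultimately have "q + b = 0" using UQ by metis
        then have "q = - b" by (simp add: eq_neg_iff_add_eq_0)
        then have "q \<in> F" using * sub' by (simp add: subspace_neg)
        then have "(u - q) + q \<in> F" using uqF sub' by (intro subspace_add)
        with uF show False by simp
      qed
    next
      fix k assume "k \<noteq> NU" "k \<noteq> NQ"
      then show "(k \<in> {NV, NE2} \<and> u \<in> S k \<and> q \<in> S k) \<or>
        (k \<notin> {NV, NE2} \<and> k \<in> {NE3} \<and> u - q \<in> S k \<and> S k \<subseteq> F) \<or>
        (k \<notin> {NV, NE2} \<and> k \<notin> {NE3} \<and> S k \<subseteq> {0} \<and> S k \<subseteq> F)"
        using u q uqF inV[of NU] inV[of NQ] by (cases k) (auto simp: set_defs)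
    qed (use u q uqF sub' in \<open>simp_all add: set_defs\<close>)
    with 4 show ?thesis by (simp add: summand_model_def)
  next
    case 5
    have UQ: "x = 0" if "x \<in> U" "x \<in> Q" for x
      using trivial[OF 5(3)] that by (auto simp: set_defs)
    have D23: "leval S meet23 = F" using coincide[OF 5(4) le(3)] by (simp add: F_def)
    obtain x where x: "x \<in> leval S meet13" "x \<notin> F" using proper[OF 5(5) le(2)] by (auto simp: F_def)
    then obtain u e q e' where u: "x = u + e" "u \<in> U" "e \<in> F"
      and q: "x = q + e'" "q \<in> Q" "e' \<in> F" unfolding m13 by blast
    have "u - q = e' - e" using u(1) q(1) by (simp add: algebra_simps)
    then have uqF: "u - q \<in> F" using u q sub' by (simp add: subspace_diff)
    then have uqE: "u - q \<in> E" using FE by blast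
    \<comment> \<open>Now E2 also meets the plane in the diagonal and takes over the part of E3. A
      dependence would put \<open>q\<close> and \<open>u\<close> into E2 and therefore
      \<open>x\<close> into the value of \<open>meet23\<close>, which is already known to be
      E3.\<close>
    have "\<exists>\<alpha> \<beta>. splits (plane_model {NV} {NE2, NE3}) S \<alpha> \<beta>"
    proof (rule splits_plane[OF S, of u q E "{0}"])
      fix a z b :: 'b assume *: "a \<in> S NU" "z \<in> {0}" "b \<in> S NQ" "b \<in> E"
      show "u - q \<noteq> a + z + b"
      proof
        assume "u - q = a + z + b"
        then have "u - a = q + b" using * by (simp add: algebra_simps)
        moreover have "u - a \<in> U" "q + b \<in> Q"
          using * u q sub' by (simp_all add: set_defs subspace_add subspace_diff)
        ultimately have "q + b = 0" using UQ by metis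
        then have "q = - b" by (simp add: eq_neg_iff_add_eq_0)
        then have qE: "q \<in> E" using * sub' by (simp add: subspace_neg)
        then have "(u - q) + q \<in> E" using uqE sub' by (intro subspace_add)
        then have "u \<in> E" by simp
        with u have "x \<in> {x + y | x y. x \<in> U \<inter> E \<and> y \<in> F}" by blast
        moreover have "x \<in> {x + y | x y. x \<in> Q \<inter> E \<and> y \<in> F}" using q qE by blast
        ultimately have "x \<in> leval S meet23" unfolding m23 by blast
        with x(2) D23 show False by simp
      qed
    next
      fix k assume "k \<noteq> NU" "k \<noteq> NQ"
      then show "(k \<in> {NV} \<and> u \<in> S k \<and> q \<in> S k) \<or>
        (k \<notin> {NV} \<and> k \<in> {NE2, NE3} \<and> u - q \<in> S k \<and> S k \<subseteq> E) \<or>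
        (k \<notin> {NV} \<and> k \<notin> {NE2, NE3} \<and> S k \<subseteq> {0} \<and> S k \<subseteq> E)"
        using u q uqF uqE FE inV[of NU] inV[of NQ] by (cases k) (auto simp: set_defs)
    qed (use u q uqE sub' in \<open>simp_all add: set_defs\<close>)
    with 5 show ?thesis by (simp add: summand_model_def)
  next
    case 6
    have D13: "leval S meet13 = F" using coincide[OF 6(5) le(2)] by (simp add: F_def)
    obtain x where x: "x \<in> leval S meet12" "x \<notin> E" using proper[OF 6(6) le(1)] by (auto simp: E_def)
    then obtain u e q e' where u: "x = u + e" "u \<in> U" "e \<in> E"
      and q: "x = q + e'" "q \<in> Q" "e' \<in> E" unfolding m12 by blast
    have "u - q = e' - e" using u(1) q(1) by (simp add: algebra_simps)
    then have uqE: "u - q \<in> E" using u q sub' by (simp add: subspace_diff)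
    \<comment> \<open>Here E3 misses the plane and has to be killed by both forms. A dependence
      would put \<open>q + b\<close> into the value of \<open>meet13\<close>, known to be E3, and
      thereby \<open>q\<close> and \<open>x\<close> into E2.\<close>
    have "\<exists>\<alpha> \<beta>. splits (plane_model {NV} {NE2}) S \<alpha> \<beta>"
    proof (rule splits_plane[OF S, of u q E F])
      fix a z b :: 'b assume *: "a \<in> S NU" "z \<in> F" "b \<in> S NQ" "b \<in> E"
      show "u - q \<noteq> a + z + b"
      proof
        assume "u - q = a + z + b"
        then have eq: "q + b = (u - a) + (- z)" by (simp add: algebra_simps)
        have "u - a \<in> U" "q + b \<in> Q" "- z \<in> F"
          using * u q sub' by (simp_all add: set_defs subspace_add subspace_diff subspace_neg)
        with eq z have "q + b \<in> {x + y | x y. x \<in> U \<and> y \<in> F}" "(q + b) + 0 \<in> {x + y | x y. x \<in> Q \<and> y \<in> F}"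
          by blast+
        then have "q + b \<in> leval S meet13" unfolding m13 by simp
        with D13 FE have "q + b \<in> E" by blast
        then have "(q + b) - b \<in> E" using * sub' by (intro subspace_diff)
        then have "q + e' \<in> E" using q sub' by (simp add: subspace_add)
        with x(2) q show False by simp
      qed
    next
      fix k assume "k \<noteq> NU" "k \<noteq> NQ"
      then show "(k \<in> {NV} \<and> u \<in> S k \<and> q \<in> S k) \<or>
        (k \<notin> {NV} \<and> k \<in> {NE2} \<and> u - q \<in> S k \<and> S k \<subseteq> E) \<or>
        (k \<notin> {NV} \<and> k \<notin> {NE2} \<and> S k \<subseteq> F \<and> S k \<subseteq> E)"
        using u q uqE FE inV[of NU] inV[of NQ] by (cases k) (auto simp: set_defs)
    qed (use u q uqE sub' in \<open>simp_all add: set_defs\<close>)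
    with 6 show ?thesis by (simp add: summand_model_def)
  next
    case 7
    \<comment> \<open>For a line in U, the subspace to be killed contains Q and the flag members
      that miss the line. The witness stays out of Q because U and Q meet in zero, out of Q + E3
      because \<open>meet23\<close> gives E3, and out of Q + E2 because \<open>meet12\<close> gives
      E2.\<close>
    have UQ: "x = 0" if "x \<in> U" "x \<in> Q" for x
      using trivial[OF 7(3)] that by (auto simp: set_defs)
    have D23: "leval S meet23 = F" using coincide[OF 7(4) le(3)] by (simp add: F_def)
    have D12: "leval S meet12 = E" using coincide[OF 7(6) le(1)] by (simp add: E_def)
    have QF: "subspace {x + y | x y. x \<in> Q \<and> y \<in> F}" "subspace {x + y | x y. x \<in> Q \<and> y \<in> E}"
      using sub' by (simp_all add: subspace_sums)
    have inc: "Q \<subseteq> {x + y | x y. x \<in> Q \<and> y \<in> A}" if "0 \<in> A" for A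
    proof
      fix x assume "x \<in> Q"
      then have "x + 0 \<in> {x + y | x y. x \<in> Q \<and> y \<in> A}" using that by blast
      then show "x \<in> {x + y | x y. x \<in> Q \<and> y \<in> A}" by simp
    qed
    consider "N ?U3 \<noteq> 1" | "N ?U3 = 1" "N ?U2 \<noteq> 1" | "N ?U3 = 1" "N ?U2 = 1" "N (Gen NU) \<noteq> 1"
      using 7(7) by blast
    then show ?thesis
    proof cases
      case a: 1
      from nonzero[OF a] obtain w where w: "w \<in> U" "w \<in> F" "w \<noteq> 0" by (auto simp: set_defs)
      have "\<exists>\<alpha> \<beta>. splits (line_model (- {NQ})) S \<alpha> \<beta>"
      proof (rule line[of Q w])
        show "w \<notin> Q" using UQ w by blast
        show "w \<in> S k" if "k \<in> - {NQ}" for k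
          using that w FE inV[of NU] by (cases k) (auto simp: set_defs)
      qed (use sub' in \<open>auto simp: set_defs\<close>)
      with 7 a show ?thesis by (simp add: summand_model_def)
    next
      case a: 2
      from nonzero[OF a(2)] obtain w where w: "w \<in> U" "w \<in> E" "w \<noteq> 0" by (auto simp: set_defs)
      have wF: "w \<notin> F" using trivial[OF a(1)] w by (auto simp: set_defs)
      have "\<exists>\<alpha> \<beta>. splits (line_model {NV, NE2, NU}) S \<alpha> \<beta>"
      proof (rule line[OF QF(1), of w])
        show "w \<notin> {x + y | x y. x \<in> Q \<and> y \<in> F}"
        proof
          assume "w \<in> {x + y | x y. x \<in> Q \<and> y \<in> F}"
          then obtain x y where xy: "w = x + y" "x \<in> Q" "y \<in> F" by blast
          then have "x = w - y" by simp
          moreover have "w - y \<in> E" using w xy FE sub' by (intro subspace_diff) auto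
          ultimately have "x \<in> E" by simp
          then have "w \<in> {x + y | x y. x \<in> Q \<inter> E \<and> y \<in> F}" using xy by blast
          moreover have "w + 0 \<in> {x + y | x y. x \<in> U \<inter> E \<and> y \<in> F}" using w z by blast
          ultimately have "w \<in> leval S meet23" unfolding m23 by simp
          with D23 wF show False by simp
        qed
        show "w \<in> S k" if "k \<in> {NV, NE2, NU}" for k
          using that w inV[of NU] by (auto simp: set_defs)
        show "S k \<subseteq> {x + y | x y. x \<in> Q \<and> y \<in> F}" if "k \<notin> {NV, NE2, NU}" for k
          using that inc[OF z(4)] sum_right[OF z(2), of F] by (cases k) (simp_all add: set_defs)
      qed
      with 7 a show ?thesis by (simp add: summand_model_def)
    next
      case a: 3
      from nonzero[OF a(3)] obtain w where w: "w \<in> U" "w \<noteq> 0" by (auto simp: set_defs)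
      have wE: "w \<notin> E" using trivial[OF a(2)] w by (auto simp: set_defs)
      have "\<exists>\<alpha> \<beta>. splits (line_model {NV, NU}) S \<alpha> \<beta>"
      proof (rule line[OF QF(2), of w])
        show "w \<notin> {x + y | x y. x \<in> Q \<and> y \<in> E}"
        proof
          assume "w \<in> {x + y | x y. x \<in> Q \<and> y \<in> E}"
          moreover have "w + 0 \<in> {x + y | x y. x \<in> U \<and> y \<in> E}" using w z by blast
          ultimately have "w \<in> leval S meet12" unfolding m12 by simp
          with D12 wE show False by simp
        qed
        show "w \<in> S k" if "k \<in> {NV, NU}" for k
          using that w inV[of NU] by (auto simp: set_defs)
        show "S k \<subseteq> {x + y | x y. x \<in> Q \<and> y \<in> E}" if "k \<notin> {NV, NU}" for k
          using that inc[OF z(3)] sum_right[OF z(2), of E] FE by (cases k) (simp_all add: set_defs)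
      qed
      with 7 a show ?thesis by (simp add: summand_model_def)
    qed
  next
    case 8
    \<comment> \<open>What remains is one subspace Q in a flag, so a line in Q has to be separated
      only from zero or from a flag member.\<close>
    have U0: "U = {0}" using trivial[OF 8(9)] by (simp add: set_defs)
    consider "N ?Q3 \<noteq> 1" | "N ?Q3 = 1" "N ?Q2 \<noteq> 1" | "N ?Q3 = 1" "N ?Q2 = 1" "N (Gen NQ) \<noteq> 1"
      | "N ?Q3 = 1" "N ?Q2 = 1" "N (Gen NQ) = 1" by blast
    then show ?thesis
    proof cases
      case a: 1
      from nonzero[OF a] obtain w where w: "w \<in> Q" "w \<in> F" "w \<noteq> 0" by (auto simp: set_defs)
      have "\<exists>\<alpha> \<beta>. splits (line_model (- {NU})) S \<alpha> \<beta>"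
      proof (rule line[of U w])
        show "w \<notin> U" using U0 w by simp
        show "w \<in> S k" if "k \<in> - {NU}" for k
          using that w FE inV[of NQ] by (cases k) (auto simp: set_defs)
      qed (use sub' in \<open>auto simp: set_defs\<close>)
      with 8 a show ?thesis by (simp add: summand_model_def)
    next
      case a: 2
      from nonzero[OF a(2)] obtain w where w: "w \<in> Q" "w \<in> E" "w \<noteq> 0" by (auto simp: set_defs)
      have "\<exists>\<alpha> \<beta>. splits (line_model {NV, NE2, NQ}) S \<alpha> \<beta>"
      proof (rule line[of F w])
        show "w \<notin> F" using trivial[OF a(1)] w by (auto simp: set_defs)
        show "w \<in> S k" if "k \<in> {NV, NE2, NQ}" for k
          using that w inV[of NQ] by (auto simp: set_defs)
        show "S k \<subseteq> F" if "k \<notin> {NV, NE2, NQ}" for k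
          using that U0 zero_sub by (cases k) (simp_all add: set_defs)
      qed (use sub' in simp_all)
      with 8 a show ?thesis by (simp add: summand_model_def)
    next
      case a: 3
      from nonzero[OF a(3)] obtain w where w: "w \<in> Q" "w \<noteq> 0" by (auto simp: set_defs)
      have "\<exists>\<alpha> \<beta>. splits (line_model {NV, NQ}) S \<alpha> \<beta>"
      proof (rule line[of E w])
        show "w \<notin> E" using trivial[OF a(2)] w by (auto simp: set_defs)
        show "w \<in> S k" if "k \<in> {NV, NQ}" for k
          using that w inV[of NQ] by (auto simp: set_defs)
        show "S k \<subseteq> E" if "k \<notin> {NV, NQ}" for k
          using that U0 zero_sub FE by (cases k) (simp_all add: set_defs)
      qed (use sub' in simp_all)
      with 8 a show ?thesis by (simp add: summand_model_def)
    next
      case a: 4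
      have Q0: "Q = {0}" using trivial[OF a(3)] by (simp add: set_defs)
      have "subspace {0}" by simp
      note flag_line = line[OF this]
      consider "N (Gen NE3) \<noteq> 1" | "N (Gen NE3) = 1" "N (Gen NE2) \<noteq> 1"
        | "N (Gen NE3) = 1" "N (Gen NE2) = 1" by blast
      then show ?thesis
      proof cases
        case b: 1
        from nonzero[OF b] obtain w where w: "w \<in> F" "w \<noteq> 0" by (auto simp: set_defs)
        have "\<exists>\<alpha> \<beta>. splits (line_model {NV, NE2, NE3}) S \<alpha> \<beta>"
        proof (rule flag_line[of w])
          show "w \<in> S k" if "k \<in> {NV, NE2, NE3}" for k
            using that w FE inV[of NE3] by (auto simp: set_defs)
          show "S k \<subseteq> {0}" if "k \<notin> {NV, NE2, NE3}" for k
            using that U0 Q0 by (cases k) (simp_all add: set_defs)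
        qed (use w in simp)
        with 8 a b show ?thesis by (simp add: summand_model_def)
      next
        case b: 2
        from nonzero[OF b(2)] obtain w where w: "w \<in> E" "w \<noteq> 0" by (auto simp: set_defs)
        have "\<exists>\<alpha> \<beta>. splits (line_model {NV, NE2}) S \<alpha> \<beta>"
        proof (rule flag_line[of w])
          show "w \<in> S k" if "k \<in> {NV, NE2}" for k
            using that w inV[of NE2] by (auto simp: set_defs)
          show "S k \<subseteq> {0}" if "k \<notin> {NV, NE2}" for k
            using that U0 Q0 trivial[OF b(1)] by (cases k) (simp_all add: set_defs)
        qed (use w in simp)
        with 8 a b show ?thesis by (simp add: summand_model_def)
      next
        case b: 3
        obtain w where w: "w \<in> S NV" "w \<noteq> 0" using subspace_nonzero[OF sub nontriv] by blast
        have "\<exists>\<alpha> \<beta>. splits (line_model {NV}) S \<alpha> \<beta>"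
        proof (rule flag_line[of w])
          show "S k \<subseteq> {0}" if "k \<notin> {NV}" for k
            using that U0 Q0 trivial[OF b(1)] trivial[OF b(2)] by (cases k) (simp_all add: set_defs)
        qed (use w in simp_all)
        with 8 a b show ?thesis by (simp add: summand_model_def)
      qed
    qed
  qed
  moreover have "N = (\<lambda>t. card (leval S t))" by (simp add: N_def fun_eq_iff)
  ultimately show ?thesis by simp
qed

text \<open>Equal invariants select the same model for both systems. After splitting it off on both
  sides, the product formula \<open>splits_card\<close> leaves complements with equal invariants in
  smaller ambient spaces; an isomorphism between them extends over the model.\<close>

theorem flagged_pair_iso:
  assumes "flagged_pair S" "flagged_pair S'"
    and "\<And>t. t \<in> invariant_terms \<Longrightarrow> card (leval S t) = card (leval S' t)"
  shows "\<exists>f. (\<forall>x y. f (x + y) = f x + f y) \<and> (\<forall>c x. f (scale c x) = scale c (f x)) \<and> (\<forall>k. f ` S k = S' k)"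
  using assms
proof (induction "card (S NV)" arbitrary: S S' rule: less_induct)
  case less
  let ?C = "summand_model (\<lambda>t. card (leval S t)) :: node \<Rightarrow> ('a \<times> 'a) set"
  have cV: "card (S NV) = card (S' NV)"
    using less.prems(3)[of "Gen NV"] by (simp add: invariant_terms_def)
  have sub: "subspace (S k)" "subspace (S' k)" for k
    using less.prems(1,2) by (auto simp: flagged_pair_def)
  show ?case
  proof (cases "card (S NV) = 1")
    case True
    then have "S NV = {0}" "S' NV = {0}"
      using cV subspace_card_1[OF sub(1)] subspace_card_1[OF sub(2)] by auto
    moreover have "R k = {0}" if "flagged_pair R" "R NV = {0}" for R k
    proof
      show "R k \<subseteq> {0}" using that by (auto simp: flagged_pair_def)
      show "{0} \<subseteq> R k" using that(1) by (simp add: flagged_pair_def subspace_0)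
    qed
    ultimately have "S k = {0}" "S' k = {0}" for k
      using less.prems(1,2) by simp_all
    then show ?thesis by (intro exI[of _ "\<lambda>x. x"]) simp
  next
    case False
    have model_eq: "summand_model (\<lambda>t. card (leval S' t)) = ?C"
      using less.prems(3) by (intro summand_model_cong) simp
    obtain \<alpha> \<beta> where sp: "splits ?C S \<alpha> \<beta>"
      using splits_summand_model[OF less.prems(1) False] by blast
    obtain \<alpha>' \<beta>' where sp': "splits ?C S' \<alpha>' \<beta>'"
      using splits_summand_model[OF less.prems(2)] False cV unfolding model_eq by auto
    let ?K = "complement S \<alpha>" and ?K' = "complement S' \<alpha>'"
    have inv: "card (leval ?K t) = card (leval ?K' t)" if "t \<in> invariant_terms" for t
    proof -
      have "card (leval ?C t) * card (leval ?K t) = card (leval ?C t) * card (leval ?K' t)"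
        using less.prems(3)[OF that] splits_card[OF sp less.prems(1)] splits_card[OF sp' less.prems(2)]
        by metis
      \<comment> \<open>The field is arbitrary here, so finiteness of the model is not evident. The
        factor is nonzero because its product with the other one is the positive cardinality of a
        term value of \<open>S\<close>.\<close>
      moreover have "card (leval ?C t) \<noteq> 0"
        using leval_card_pos(2)[OF less.prems(1), of t] splits_card[OF sp less.prems(1), of t] by auto
      ultimately show ?thesis by simp
    qed
    have smaller: "card (?K NV) < card (S NV)"
    proof (rule psubset_card_mono)
      show "finite (S NV)" using less.prems(1) by (simp add: flagged_pair_def)
      have "\<beta> (1, 0) \<in> S NV" "\<alpha> (\<beta> (1, 0)) = (1, 0)"
        using splitsD(5,6)[OF sp summand_model_nontrivial] by auto
      then have "\<beta> (1, 0) \<in> S NV - ?K NV" by (simp add: complement_def zero_prod_def)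
      then show "?K NV \<subset> S NV" by (auto simp: complement_def)
    qed
    have "\<exists>h. (\<forall>x y. h (x + y) = h x + h y) \<and> (\<forall>c x. h (scale c x) = scale c (h x)) \<and>
        (\<forall>k. h ` ?K k = ?K' k)"
      by (rule less.hyps[OF smaller complement_flagged_pair[OF sp less.prems(1)]
          complement_flagged_pair[OF sp' less.prems(2)] inv])
    then obtain h where "(\<forall>x y. h (x + y) = h x + h y) \<and> (\<forall>c x. h (scale c x) = scale c (h x)) \<and>
        (\<forall>k. h ` ?K k = ?K' k)" ..
    then have h: "h (x + y) = h x + h y" "h (scale c x) = scale c (h x)" "h ` ?K k = ?K' k" for x y c k
      by simp_all
    obtain f where "\<And>x y. f (x + y) = f x + f y" "\<And>c x. f (scale c x) = scale c (f x)"
      "\<And>k. f ` S k = S' k"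
      by (rule iso_extend_summand[OF sp sp' less.prems(1,2) h]) (rule that)
    then show ?thesis by (intro exI[of _ f]) simp
  qed
qed

lemma leval_image:
  assumes S: "flagged_pair S" and add: "\<And>x y. f (x + y) = f x + f y"
    and inj: "inj_on f (S NV)" and img: "\<And>k. f ` S k = S' k"
  shows "f ` leval S t = leval S' t"
proof (induction t)
  case (Meet s t)
  have "f ` (leval S s \<inter> leval S t) = f ` leval S s \<inter> f ` leval S t"
    using leval_subset[OF S] by (intro inj_on_image_Int[OF inj]) auto
  with Meet show ?case by simp
next
  case (Join s t)
  have "f ` {x + y | x y. x \<in> leval S s \<and> y \<in> leval S t} =
    {x + y | x y. x \<in> f ` leval S s \<and> y \<in> f ` leval S t}" (is "_ ` ?L = ?R")
  proof (intro equalityI subsetI)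
    fix z assume "z \<in> ?R"
    then obtain x y where "z = f x + f y" "x \<in> leval S s" "y \<in> leval S t" by blast
    then have "z = f (x + y)" "x + y \<in> ?L" using add by auto
    then show "z \<in> f ` ?L" by (rule image_eqI)
  qed (use add in auto)
  with Join show ?case by simp
qed (simp add: img)

text \<open>A map between finite ambient spaces of equal size that is onto is injective there, hence
  commutes with meets as well as joins and preserves the size of every term value. The converse is
  \<open>flagged_pair_iso\<close>.\<close>

theorem flagged_pair_iso_iff:
  assumes "flagged_pair S" "flagged_pair S'" "card (S NV) = card (S' NV)"
  shows "(\<exists>f. (\<forall>x y. f (x + y) = f x + f y) \<and> (\<forall>c x. f (scale c x) = scale c (f x)) \<and> (\<forall>k. f ` S k = S' k))
    \<longleftrightarrow> (\<forall>t\<in>invariant_terms. card (leval S t) = card (leval S' t))"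
proof
  assume "\<exists>f. (\<forall>x y. f (x + y) = f x + f y) \<and> (\<forall>c x. f (scale c x) = scale c (f x)) \<and> (\<forall>k. f ` S k = S' k)"
  then obtain f where f: "\<And>x y. f (x + y) = f x + f y" "\<And>k. f ` S k = S' k" by auto
  have inj: "inj_on f (S NV)"
    using assms f(2)[of NV] by (intro eq_card_imp_inj_on) (simp_all add: flagged_pair_def)
  show "\<forall>t\<in>invariant_terms. card (leval S t) = card (leval S' t)"
  proof
    fix t
    have "card (f ` leval S t) = card (leval S t)"
      by (rule card_image) (rule inj_on_subset[OF inj leval_subset[OF assms(1)]])
    then show "card (leval S t) = card (leval S' t)"
      by (simp add: leval_image[OF assms(1) f(1) inj f(2)])
  qed
qed (use flagged_pair_iso[OF assms(1,2)] in simp)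

end

section \<open>Subspaces and row spaces over a finite field\<close>

lemma is_subspace_iff:
  "is_subspace n W \<longleftrightarrow> W \<subseteq> carrier_vec n \<and> 0\<^sub>v n \<in> W \<and> (\<forall>v\<in>W. \<forall>w\<in>W. v + w \<in> W) \<and>
    (\<forall>c. \<forall>v\<in>W. c \<cdot>\<^sub>v v \<in> (W :: 'a::field vec set))"
proof -
  interpret vec_space "TYPE('a)" n .
  show ?thesis
    unfolding VectorSpace.subspace_def submodule_def
    using vectorspace_axioms module_axioms
    by (auto simp: class_ring_simps module_vec_simps)
qed

lemma rowsp_eq:
  fixes A :: "'a::field mat"
  assumes "A \<in> carrier_mat r n"
  shows "rowsp n A = (\<lambda>c. A\<^sup>T *\<^sub>v c) ` carrier_vec r"
  using vec_space.row_space_eq[OF assms] assms by auto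

lemma is_subspace_rowsp:
  fixes A :: "'a::field mat"
  assumes "A \<in> carrier_mat r n"
  shows "is_subspace n (rowsp n A)"
proof -
  have T: "A\<^sup>T \<in> carrier_mat n r" using assms by simp
  show ?thesis
    unfolding is_subspace_iff rowsp_eq[OF assms]
  proof (intro conjI ballI allI)
    show "0\<^sub>v n \<in> (\<lambda>c. A\<^sup>T *\<^sub>v c) ` carrier_vec r"
      using T by (intro image_eqI[of _ _ "0\<^sub>v r"]) auto
  next
    fix v w assume "v \<in> (\<lambda>c. A\<^sup>T *\<^sub>v c) ` carrier_vec r" "w \<in> (\<lambda>c. A\<^sup>T *\<^sub>v c) ` carrier_vec r"
    then obtain c d where "c \<in> carrier_vec r" "d \<in> carrier_vec r" "v = A\<^sup>T *\<^sub>v c" "w = A\<^sup>T *\<^sub>v d" by auto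
    then show "v + w \<in> (\<lambda>c. A\<^sup>T *\<^sub>v c) ` carrier_vec r"
      using T by (intro image_eqI[of _ _ "c + d"]) (auto simp: mult_add_distrib_mat_vec)
  next
    fix a v assume "v \<in> (\<lambda>c. A\<^sup>T *\<^sub>v c) ` carrier_vec r"
    then obtain c where "c \<in> carrier_vec r" "v = A\<^sup>T *\<^sub>v c" by auto
    then show "a \<cdot>\<^sub>v v \<in> (\<lambda>c. A\<^sup>T *\<^sub>v c) ` carrier_vec r"
      using T by (intro image_eqI[of _ _ "a \<cdot>\<^sub>v c"]) (auto simp: mult_mat_vec)
  qed (use T in auto)
qed

lemma is_subspace_inter:
  "is_subspace n V \<Longrightarrow> is_subspace n W \<Longrightarrow> is_subspace n (V \<inter> W)"
  by (auto simp: is_subspace_iff)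

lemma is_subspace_vanish:
  "is_subspace n {v \<in> carrier_vec n. \<forall>i<m. v $ i = (0 :: 'a::field)}" if "m \<le> n"
  using that by (auto simp: is_subspace_iff)

lemma last_coords_eq:
  assumes "m + d = n"
  shows "last_coords n d = {v \<in> carrier_vec n. \<forall>i<m. v $ i = (0 :: 'a::field)}" (is "_ = ?E")
proof -
  interpret vec_space "TYPE('a)" n .
  let ?B = "{unit_vec n i | i. n - d \<le> i \<and> i < n}"
  have m: "n - d = m" "m \<le> n" using assms by auto
  have sub: "is_subspace n ?E" by (rule is_subspace_vanish) (use m in simp)
  have carr: "?B \<subseteq> carrier_vec n" by auto
  have eq: "last_coords n d = span ?B" by (simp add: last_coords_def)
  show ?thesis
  proof
    have "?B \<subseteq> ?E" using m by auto
    then show "last_coords n d \<subseteq> ?E"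
      unfolding eq using sub by (intro span_is_subset) (auto simp: VectorSpace.subspace_def)
  next
    have subB: "is_subspace n (span ?B)"
      using carr by (intro span_is_subspace) auto
    show "?E \<subseteq> last_coords n d"
    proof
      fix v assume v: "v \<in> ?E"
      \<comment> \<open>\<open>w k\<close> keeps the first \<open>k\<close> coordinates of
        \<open>v\<close>. Each further coordinate adds a multiple of a unit vector, with coefficient
        zero as long as \<open>k < m\<close>.\<close>
      define w where "w k = vec n (\<lambda>i. if i < k then v $ i else 0)" for k
      have in_span: "w k \<in> span ?B" if "k \<le> n" for k
        using that
      proof (induction k)
        case 0
        have "w 0 = 0\<^sub>v n" by (auto simp: w_def)
        then show ?case using subB by (simp add: is_subspace_iff)
      next
        case (Suc k)
        have step: "w (Suc k) = w k + v $ k \<cdot>\<^sub>v unit_vec n k"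
          using Suc.prems by (intro eq_vecI) (auto simp: w_def unit_vec_def less_Suc_eq)
        have "v $ k \<cdot>\<^sub>v unit_vec n k \<in> span ?B"
        proof (cases "k < m")
          case True
          then have "v $ k \<cdot>\<^sub>v unit_vec n k = 0\<^sub>v n" using v by auto
          then show ?thesis using subB by (simp add: is_subspace_iff)
        next
          case False
          then have "unit_vec n k \<in> ?B" using Suc.prems m by auto
          then have "unit_vec n k \<in> span ?B" using in_own_span[of ?B] carr by blast
          then show ?thesis using subB by (simp add: is_subspace_iff)
        qed
        then show ?case using Suc subB by (simp add: step is_subspace_iff)
      qed
      have "w n = v" using v by (intro eq_vecI) (auto simp: w_def)
      with in_span[of n] show "v \<in> last_coords n d" unfolding eq by simp
    qed
  qed
qed

section \<open>Cardinalities in place of dimensions\<close>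

lemma
  shows finite_carrier_vec: "finite (carrier_vec n :: 'a::finite vec set)"
    and card_carrier_vec: "card (carrier_vec n :: 'a::finite vec set) = CARD('a) ^ n"
proof -
  let ?L = "{xs :: 'a list. set xs \<subseteq> UNIV \<and> length xs = n}"
  have bij: "bij_betw vec_of_list ?L (carrier_vec n)"
  proof (rule bij_betw_byWitness[where f' = list_of_vec])
    show "vec_of_list ` ?L \<subseteq> carrier_vec n"
      unfolding carrier_vec_def by (rule image_subsetI) simp
    show "list_of_vec ` carrier_vec n \<subseteq> ?L"
      unfolding carrier_vec_def by (rule image_subsetI) simp
  qed (simp_all add: vec_list list_vec)
  have "finite ?L" "card ?L = CARD('a) ^ n"
    using finite_lists_length_eq[of "UNIV :: 'a set" n] card_lists_length_eq[of "UNIV :: 'a set" n] by auto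
  then show "finite (carrier_vec n :: 'a vec set)" "card (carrier_vec n :: 'a vec set) = CARD('a) ^ n"
    using bij_betw_finite[OF bij] bij_betw_same_card[OF bij] by simp_all
qed

text \<open>Coordinates in a basis match \<open>W\<close> with the functions from the basis to the
  field. A finite basis exists because the finite set \<open>W\<close> generates itself.\<close>

lemma card_subspace_dim:
  fixes W :: "'a::{field,finite} vec set"
  assumes "is_subspace n W"
  shows "card W = CARD('a) ^ subspace_dim n W"
proof -
  interpret V: vec_space "TYPE('a)" n .
  let ?W = "module_vec TYPE('a) n\<lparr>carrier := W\<rparr>"
  interpret W: vectorspace "class_ring :: 'a ring" ?W
    by (rule V.subspace_is_vs[OF assms])
  have "finite W"
    using assms finite_carrier_vec finite_subset by (auto simp: is_subspace_iff)
  moreover have "W.gen_set W"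
    using W.in_own_span[of W] W.span_is_subset2[of W] by auto
  ultimately have "W.fin_dim" unfolding W.fin_dim_def by auto
  then obtain B where B: "finite B" "W.basis B" using W.finite_basis_exists by blast
  have sub: "B \<subseteq> W" using B(2) by (auto simp: W.basis_def)
  have uniq: "\<exists>!a. a \<in> B \<rightarrow>\<^sub>E UNIV \<and> W.lincomb a B = v" if "v \<in> W" for v
    using W.basis_criterion[of B] B sub that by auto
  have "bij_betw (\<lambda>a. W.lincomb a B) (B \<rightarrow>\<^sub>E UNIV) W"
    unfolding bij_betw_def
  proof
    have closed: "W.lincomb a B \<in> W" for a
      using W.lincomb_closed[of B a] sub by auto
    show "inj_on (\<lambda>a. W.lincomb a B) (B \<rightarrow>\<^sub>E UNIV)"
      using uniq[OF closed] by (intro inj_onI) metis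
    show "(\<lambda>a. W.lincomb a B) ` (B \<rightarrow>\<^sub>E UNIV) = W"
      using uniq closed by blast
  qed
  from bij_betw_same_card[OF this] have "card W = card (B \<rightarrow>\<^sub>E (UNIV :: 'a set))" by simp
  also have "\<dots> = CARD('a) ^ card B" by (simp add: card_funcsetE B(1))
  finally show ?thesis using W.dim_basis[OF B] by simp
qed

lemma subspace_dim_eq_iff:
  fixes V W :: "'a::{field,finite} vec set"
  assumes "is_subspace n V" "is_subspace n W"
  shows "subspace_dim n V = subspace_dim n W \<longleftrightarrow> card V = card W"
proof -
  have "card {0, 1 :: 'a} \<le> CARD('a)" by (intro card_mono) auto
  then have "CARD('a) > 1" by simp
  then show ?thesis using assms by (simp add: card_subspace_dim)
qed

section \<open>Row vectors times block triangular matrices\<close>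

lemma block_ut2_carrier:
  assumes "A \<in> carrier_mat r1 m1" "B \<in> carrier_mat r1 m2" "D \<in> carrier_mat r2 m2"
  shows "block_ut2 A B D \<in> carrier_mat (r1 + r2) (m1 + m2)"
  using assms by (auto simp: block_ut2_def)

lemma block_ut2_row_combination:
  fixes A :: "'a::field mat"
  assumes "A \<in> carrier_mat r1 m1" "B \<in> carrier_mat r1 m2" "D \<in> carrier_mat r2 m2"
    and "a \<in> carrier_vec r1" "d \<in> carrier_vec r2"
  shows "(block_ut2 A B D)\<^sup>T *\<^sub>v (a @\<^sub>v d) = (A\<^sup>T *\<^sub>v a) @\<^sub>v (B\<^sup>T *\<^sub>v a + D\<^sup>T *\<^sub>v d)"
proof -
  have "(block_ut2 A B D)\<^sup>T = four_block_mat A\<^sup>T (0\<^sub>m m1 r2) B\<^sup>T D\<^sup>T"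
    unfolding block_ut2_def using assms
    by (subst transpose_four_block_mat[of _ r1 m1 _ m2 _ r2]) auto
  also have "\<dots> *\<^sub>v (a @\<^sub>v d) = (A\<^sup>T *\<^sub>v a + 0\<^sub>m m1 r2 *\<^sub>v d) @\<^sub>v (B\<^sup>T *\<^sub>v a + D\<^sup>T *\<^sub>v d)"
    using assms by (intro four_block_mat_mult_vec) auto
  also have "A\<^sup>T *\<^sub>v a + 0\<^sub>m m1 r2 *\<^sub>v d = A\<^sup>T *\<^sub>v a" using assms by auto
  finally show ?thesis .
qed

lemma carrier_vec_append:
  "(carrier_vec (r + s) :: 'a vec set) = {a @\<^sub>v d | a d. a \<in> carrier_vec r \<and> d \<in> carrier_vec s}"
  (is "?L = ?R")
proof
  show "?L \<subseteq> ?R"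
  proof
    fix v :: "'a vec" assume "v \<in> carrier_vec (r + s)"
    then have "v = vec_first v r @\<^sub>v vec_last v s" by simp
    then show "v \<in> ?R"
      using vec_first_carrier vec_last_carrier by blast
  qed
qed auto

lemma rowsp_block_ut2:
  fixes A :: "'a::field mat"
  assumes "A \<in> carrier_mat r1 m1" "B \<in> carrier_mat r1 m2" "D \<in> carrier_mat r2 m2"
  shows "rowsp (m1 + m2) (block_ut2 A B D) =
    {(A\<^sup>T *\<^sub>v a) @\<^sub>v (B\<^sup>T *\<^sub>v a + D\<^sup>T *\<^sub>v d) | a d. a \<in> carrier_vec r1 \<and> d \<in> carrier_vec r2}"
  unfolding rowsp_eq[OF block_ut2_carrier[OF assms]] carrier_vec_append
proof safe
  fix a d :: "'a vec" assume *: "a \<in> carrier_vec r1" "d \<in> carrier_vec r2"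
  note eq = block_ut2_row_combination[OF assms *]
  show "\<exists>a' d'. (block_ut2 A B D)\<^sup>T *\<^sub>v (a @\<^sub>v d) = A\<^sup>T *\<^sub>v a' @\<^sub>v (B\<^sup>T *\<^sub>v a' + D\<^sup>T *\<^sub>v d') \<and>
      a' \<in> carrier_vec r1 \<and> d' \<in> carrier_vec r2"
    using eq * by blast
  show "A\<^sup>T *\<^sub>v a @\<^sub>v (B\<^sup>T *\<^sub>v a + D\<^sup>T *\<^sub>v d) \<in>
      (\<lambda>c. (block_ut2 A B D)\<^sup>T *\<^sub>v c) ` {a @\<^sub>v d | a d. a \<in> carrier_vec r1 \<and> d \<in> carrier_vec r2}"
    unfolding eq[symmetric] using * by blast
qed

text \<open>\<open>block_ut3\<close> groups the first two block rows and columns. Grouping the last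
  two instead exposes the lower right 2 by 2 block; the four-block matrix without lower rows is
  \<open>B\<close> placed beside \<open>C\<close>.\<close>

lemma block_ut3_assoc:
  assumes "A \<in> carrier_mat r1 m1" "B \<in> carrier_mat r1 m2" "C \<in> carrier_mat r1 m3"
    "D \<in> carrier_mat r2 m2" "E \<in> carrier_mat r2 m3" "F \<in> carrier_mat r3 m3"
  shows "block_ut3 A B C D E F =
    block_ut2 A (four_block_mat B C (0\<^sub>m 0 m2) (0\<^sub>m 0 m3)) (block_ut2 D E F)"
  using assms by (intro eq_matI) (auto simp: block_ut3_def block_ut2_def append_rows_def)

section \<open>Row spaces of block triangular matrices\<close>

text \<open>
  Row vectors of all lengths are embedded in the type \<open>nat \<Rightarrow> 'a\<close>, which carries the type class structure
  required by the classification.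
\<close>

definition coords :: "'a::zero vec \<Rightarrow> nat \<Rightarrow> 'a" where
  "coords v i = (if i < dim_vec v then v $ i else 0)"

text \<open>For \<open>m \<le> n\<close>, the embedded span of the unit vectors with indices from
  \<open>m\<close> to \<open>n - 1\<close>, that is, a flag member.\<close>

definition tail_space :: "nat \<Rightarrow> nat \<Rightarrow> (nat \<Rightarrow> 'a::zero) set" where
  "tail_space n m = {f. (\<forall>i<m. f i = 0) \<and> (\<forall>i\<ge>n. f i = 0)}"

text \<open>Serves as the quotient map by \<open>tail_space n m\<close>, with values in the same
  type; its counterpart \<open>shift\<close> identifies \<open>tail_space n m\<close> with embedded
  vectors of length \<open>n - m\<close>.\<close>

definition trunc :: "nat \<Rightarrow> (nat \<Rightarrow> 'a::zero) \<Rightarrow> nat \<Rightarrow> 'a" where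
  "trunc m f i = (if i < m then f i else 0)"

definition shift :: "nat \<Rightarrow> (nat \<Rightarrow> 'a) \<Rightarrow> nat \<Rightarrow> 'a" where
  "shift m f i = f (i + m)"

lemma inj_on_coords: "inj_on coords (carrier_vec n)"
proof (rule inj_onI)
  fix v w :: "'a vec" assume *: "v \<in> carrier_vec n" "w \<in> carrier_vec n" "coords v = coords w"
  show "v = w"
  proof (rule eq_vecI)
    fix i assume "i < dim_vec w"
    moreover have "coords v i = coords w i" using *(3) by simp
    ultimately show "v $ i = w $ i" using *(1,2) by (simp add: coords_def)
  qed (use * in simp)
qed

lemma coords_in_tail_space:
  "v \<in> carrier_vec n \<Longrightarrow> coords v \<in> tail_space n m \<longleftrightarrow> (\<forall>i<m. i < n \<longrightarrow> v $ i = 0)"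
  by (auto simp: coords_def tail_space_def)

lemma coords_vec: "coords (vec n f) = f" if "f \<in> tail_space n m"
  using that by (auto simp: coords_def tail_space_def)

lemma coords_image_tail_space:
  assumes "m \<le> n"
  shows "coords ` {v \<in> carrier_vec n. \<forall>i<m. v $ i = 0} = tail_space n m"
proof (intro equalityI subsetI)
  fix f assume f: "f \<in> tail_space n m"
  have "vec n f \<in> {v \<in> carrier_vec n. \<forall>i<m. v $ i = 0}"
    using f assms by (simp add: tail_space_def)
  then show "f \<in> coords ` {v \<in> carrier_vec n. \<forall>i<m. v $ i = 0}"
    by (rule image_eqI[rotated]) (simp add: coords_vec[OF f])
qed (auto simp: coords_in_tail_space)

lemma coords_image_carrier: "coords ` carrier_vec n = tail_space n 0"
  using coords_image_tail_space[of 0 n] by simp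

lemma coords_image_Int:
  assumes "X \<subseteq> carrier_vec n" "Y \<subseteq> carrier_vec n"
  shows "coords ` (X \<inter> Y) = coords ` X \<inter> coords ` Y"
  using assms by (rule inj_on_image_Int[OF inj_on_coords])

lemma card_coords_image:
  assumes "X \<subseteq> carrier_vec n"
  shows "card (coords ` X) = card X"
  using inj_on_subset[OF inj_on_coords assms] by (rule card_image)

lemma finite_tail_space: "finite (tail_space n m :: (nat \<Rightarrow> 'a::{field,finite}) set)"
proof (rule finite_subset)
  show "tail_space n m \<subseteq> coords ` (carrier_vec n :: 'a vec set)"
    unfolding coords_image_carrier by (auto simp: tail_space_def)
qed (simp add: finite_carrier_vec)

lemma coords_add:
  "v \<in> carrier_vec n \<Longrightarrow> w \<in> carrier_vec n \<Longrightarrow> coords (v + w) = coords v + (coords w :: nat \<Rightarrow> 'a::monoid_add)"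
  by (rule ext) (simp add: coords_def)

lemma coords_smult: "coords (c \<cdot>\<^sub>v v) = (\<lambda>i. c * coords v i)" for c :: "'a::mult_zero"
  by (rule ext) (simp add: coords_def)

lemma trunc_coords_append: "x \<in> carrier_vec m \<Longrightarrow> trunc m (coords (x @\<^sub>v y)) = coords x"
  by (rule ext) (simp add: trunc_def coords_def)

lemma shift_coords_append: "x \<in> carrier_vec m \<Longrightarrow> shift m (coords (x @\<^sub>v y)) = coords y"
  by (rule ext) (simp add: shift_def coords_def)

lemma coords_append_nth: "x \<in> carrier_vec m \<Longrightarrow> i < m \<Longrightarrow> coords (x @\<^sub>v y) i = x $ i"
  by (simp add: coords_def)

lemma coords_zero_append: "y \<in> carrier_vec k \<Longrightarrow> coords (0\<^sub>v m @\<^sub>v y) \<in> tail_space (m + k) m"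
  by (auto simp: coords_def tail_space_def)

lemma zero_vec_append: "0\<^sub>v (m + k) = 0\<^sub>v m @\<^sub>v 0\<^sub>v k"
  by (rule eq_vecI) simp_all

lemma transpose_mult_vec_carrier: "A \<in> carrier_mat r m \<Longrightarrow> A\<^sup>T *\<^sub>v a \<in> carrier_vec m"
  by (rule carrier_vecI) simp

lemma transpose_mult_zero_vec: "A \<in> carrier_mat r m \<Longrightarrow> A\<^sup>T *\<^sub>v 0\<^sub>v r = 0\<^sub>v m"
  for A :: "'a::semiring_0 mat"
  by (intro eq_vecI) auto

lemma shift_trunc: "shift m (trunc (m + k) f) = trunc k (shift m f)"
  by (rule ext) (simp add: trunc_def shift_def add.commute)

lemma inj_on_shift: "inj_on (shift m) {f. \<forall>i<m. f i = 0}"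
proof (rule inj_onI)
  fix f g :: "nat \<Rightarrow> 'a" assume *: "f \<in> {f. \<forall>i<m. f i = 0}" "g \<in> {f. \<forall>i<m. f i = 0}" "shift m f = shift m g"
  show "f = g"
  proof
    fix i
    show "f i = g i"
    proof (cases "i < m")
      case False
      then show ?thesis using fun_cong[OF *(3), of "i - m"] by (simp add: shift_def)
    qed (use * in simp)
  qed
qed

text \<open>Both sums are unions of cosets of the tail space, and \<open>trunc m\<close> collapses
  each coset within \<open>tail_space n 0\<close> to a point. Their intersection therefore lies over
  the intersection of the truncations, with fibres of the size of the tail space.\<close>

lemma card_meet_tail_space:
  fixes A B :: "(nat \<Rightarrow> 'a::{field,finite}) set"
  assumes AB: "A \<subseteq> tail_space n 0" "B \<subseteq> tail_space n 0" and "m \<le> n"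
  shows "card ({x + y | x y. x \<in> A \<and> y \<in> tail_space n m} \<inter> {x + y | x y. x \<in> B \<and> y \<in> tail_space n m})
    = card (trunc m ` A \<inter> trunc m ` B) * card (tail_space n m :: (nat \<Rightarrow> 'a) set)"
proof -
  let ?E = "tail_space n m :: (nat \<Rightarrow> 'a) set"
  have sum_iff: "f \<in> {x + y | x y. x \<in> X \<and> y \<in> ?E} \<longleftrightarrow> trunc m f \<in> trunc m ` X \<and> f \<in> tail_space n 0"
    if X: "X \<subseteq> tail_space n 0" for X f
  proof
    assume "f \<in> {x + y | x y. x \<in> X \<and> y \<in> ?E}"
    then obtain x y where xy: "f = x + y" "x \<in> X" "y \<in> ?E" by blast
    then have "trunc m f = trunc m x" by (intro ext) (simp add: trunc_def tail_space_def)
    moreover have "f \<in> tail_space n 0" using xy X by (auto simp: tail_space_def)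
    ultimately show "trunc m f \<in> trunc m ` X \<and> f \<in> tail_space n 0" using xy(2) by simp
  next
    assume f: "trunc m f \<in> trunc m ` X \<and> f \<in> tail_space n 0"
    then obtain x where x: "x \<in> X" "trunc m f = trunc m x" by auto
    have "f i = x i" if "i < m" for i
      using fun_cong[OF x(2), of i] that by (simp add: trunc_def)
    moreover have "x \<in> tail_space n 0" using x X by blast
    ultimately have "f - x \<in> ?E" using f by (simp add: tail_space_def)
    moreover have "f = x + (f - x)" by simp
    ultimately show "f \<in> {x + y | x y. x \<in> X \<and> y \<in> ?E}" using x(1) by blast
  qed
  let ?C = "trunc m ` A \<inter> trunc m ` B"
  have C: "g \<in> tail_space m 0" if "g \<in> ?C" for g
    using that by (auto simp: trunc_def tail_space_def)
  have "bij_betw (\<lambda>(g, e). g + e) (?C \<times> ?E)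
      ({x + y | x y. x \<in> A \<and> y \<in> ?E} \<inter> {x + y | x y. x \<in> B \<and> y \<in> ?E})" (is "bij_betw _ _ ?M")
  proof (rule bij_betw_byWitness[where f' = "\<lambda>f. (trunc m f, f - trunc m f)"])
    have trunc_sum: "trunc m (g + e) = g" if "g \<in> ?C" "e \<in> ?E" for g e
      using C[OF that(1)] that(2) by (intro ext) (simp add: trunc_def tail_space_def)
    have "g + e \<in> tail_space n 0" if "g \<in> ?C" "e \<in> ?E" for g e
      using C[OF that(1)] that(2) \<open>m \<le> n\<close> by (simp add: tail_space_def)
    with trunc_sum show "(\<lambda>(g, e). g + e) ` (?C \<times> ?E) \<subseteq> ?M"
      unfolding image_subset_iff Int_iff sum_iff[OF AB(1)] sum_iff[OF AB(2)] by simp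
    show "\<forall>a\<in>?C \<times> ?E. (\<lambda>f. (trunc m f, f - trunc m f)) (case a of (g, e) \<Rightarrow> g + e) = a"
      using trunc_sum by simp
    show "(\<lambda>f. (trunc m f, f - trunc m f)) ` ?M \<subseteq> ?C \<times> ?E"
    proof (rule image_subsetI)
      fix f assume "f \<in> ?M"
      then have f: "trunc m f \<in> ?C" "f \<in> tail_space n 0"
        unfolding Int_iff sum_iff[OF AB(1)] sum_iff[OF AB(2)] by simp_all
      then have "f - trunc m f \<in> ?E" using \<open>m \<le> n\<close> by (simp add: tail_space_def trunc_def)
      with f(1) show "(trunc m f, f - trunc m f) \<in> ?C \<times> ?E" by simp
    qed
  qed simp
  from bij_betw_same_card[OF this] show ?thesis by (simp add: card_cartesian_product)
qed

text \<open>This is full row rank.\<close>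

definition row_independent :: "'a::field mat \<Rightarrow> bool" where
  "row_independent A \<longleftrightarrow> (\<forall>a\<in>carrier_vec (dim_row A). A\<^sup>T *\<^sub>v a = 0\<^sub>v (dim_col A) \<longrightarrow> a = 0\<^sub>v (dim_row A))"

lemma coords_rowsp_block_ut2:
  fixes A :: "'a::field mat"
  assumes "A \<in> carrier_mat r1 m1" "B \<in> carrier_mat r1 m2" "D \<in> carrier_mat r2 m2"
  shows "coords ` rowsp (m1 + m2) (block_ut2 A B D) =
    {coords (A\<^sup>T *\<^sub>v a @\<^sub>v (B\<^sup>T *\<^sub>v a + D\<^sup>T *\<^sub>v d)) | a d. a \<in> carrier_vec r1 \<and> d \<in> carrier_vec r2}"
  unfolding rowsp_block_ut2[OF assms] by blast

lemma trunc_rowsp_block_ut2: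
  fixes A :: "'a::field mat"
  assumes "A \<in> carrier_mat r1 m1" "B \<in> carrier_mat r1 m2" "D \<in> carrier_mat r2 m2"
  shows "trunc m1 ` coords ` rowsp (m1 + m2) (block_ut2 A B D) = coords ` rowsp m1 A"
proof -
  have A: "A\<^sup>T *\<^sub>v a \<in> carrier_vec m1" for a
    using assms(1) by (rule transpose_mult_vec_carrier)
  show ?thesis
    unfolding coords_rowsp_block_ut2[OF assms] rowsp_eq[OF assms(1)]
  proof (intro equalityI subsetI)
    fix f assume "f \<in> coords ` (\<lambda>c. A\<^sup>T *\<^sub>v c) ` carrier_vec r1"
    then obtain a where a: "a \<in> carrier_vec r1" "f = coords (A\<^sup>T *\<^sub>v a)" by auto
    have "coords (A\<^sup>T *\<^sub>v a @\<^sub>v (B\<^sup>T *\<^sub>v a + D\<^sup>T *\<^sub>v 0\<^sub>v r2)) \<in>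
      {coords (A\<^sup>T *\<^sub>v a @\<^sub>v (B\<^sup>T *\<^sub>v a + D\<^sup>T *\<^sub>v d)) | a d. a \<in> carrier_vec r1 \<and> d \<in> carrier_vec r2}"
      using a(1) zero_carrier_vec[of r2] by blast
    then show "f \<in> trunc m1 ` {coords (A\<^sup>T *\<^sub>v a @\<^sub>v (B\<^sup>T *\<^sub>v a + D\<^sup>T *\<^sub>v d)) | a d.
        a \<in> carrier_vec r1 \<and> d \<in> carrier_vec r2}"
      by (rule rev_image_eqI) (simp add: a(2) trunc_coords_append[OF A])
  qed (auto simp: trunc_coords_append[OF A])
qed

text \<open>If a row combination vanishes in the first block, independence of the rows of
  \<open>A\<close> makes the upper coefficients zero. Then \<open>B\<close> contributes nothing, and
  what remains is an arbitrary combination of the rows of \<open>D\<close>.\<close>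

lemma shift_rowsp_block_ut2:
  fixes A :: "'a::field mat"
  assumes "A \<in> carrier_mat r1 m1" "B \<in> carrier_mat r1 m2" "D \<in> carrier_mat r2 m2" "row_independent A"
  shows "shift m1 ` (coords ` rowsp (m1 + m2) (block_ut2 A B D) \<inter> tail_space (m1 + m2) m1) = coords ` rowsp m2 D"
proof (intro equalityI subsetI)
  have A: "A\<^sup>T *\<^sub>v a \<in> carrier_vec m1" and B: "B\<^sup>T *\<^sub>v a \<in> carrier_vec m2" and D: "D\<^sup>T *\<^sub>v a \<in> carrier_vec m2" for a
    using assms(1-3) by (auto intro: transpose_mult_vec_carrier)
  {
    fix f assume "f \<in> shift m1 ` (coords ` rowsp (m1 + m2) (block_ut2 A B D) \<inter> tail_space (m1 + m2) m1)"
    then obtain a d where ad: "a \<in> carrier_vec r1" "d \<in> carrier_vec r2"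
      "coords (A\<^sup>T *\<^sub>v a @\<^sub>v (B\<^sup>T *\<^sub>v a + D\<^sup>T *\<^sub>v d)) \<in> tail_space (m1 + m2) m1"
      "f = shift m1 (coords (A\<^sup>T *\<^sub>v a @\<^sub>v (B\<^sup>T *\<^sub>v a + D\<^sup>T *\<^sub>v d)))"
      unfolding coords_rowsp_block_ut2[OF assms(1-3)] by blast
    have "A\<^sup>T *\<^sub>v a = 0\<^sub>v m1"
    proof (rule eq_vecI)
      fix i assume "i < dim_vec (0\<^sub>v m1 :: 'a vec)"
      then have i: "i < m1" by simp
      then have "coords (A\<^sup>T *\<^sub>v a @\<^sub>v (B\<^sup>T *\<^sub>v a + D\<^sup>T *\<^sub>v d)) i = 0"
        using ad(3) by (simp only: tail_space_def mem_Collect_eq)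
      with i show "(A\<^sup>T *\<^sub>v a) $ i = 0\<^sub>v m1 $ i"
        by (simp only: coords_append_nth[OF A i] index_zero_vec)
    qed (use assms(1) in simp)
    moreover have "dim_row A = r1" "dim_col A = m1" using assms(1) by auto
    ultimately have "a = 0\<^sub>v r1" using assms(4) ad(1) by (simp only: row_independent_def)
    then have "B\<^sup>T *\<^sub>v a = 0\<^sub>v m2" using transpose_mult_zero_vec[OF assms(2)] by simp
    then have "f = coords (D\<^sup>T *\<^sub>v d)"
      unfolding ad(4) shift_coords_append[OF A] using D[of d] by simp
    then show "f \<in> coords ` rowsp m2 D" unfolding rowsp_eq[OF assms(3)] using ad(2) by blast
  next
    fix f assume "f \<in> coords ` rowsp m2 D"
    then obtain d where d: "d \<in> carrier_vec r2" "f = coords (D\<^sup>T *\<^sub>v d)"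
      unfolding rowsp_eq[OF assms(3)] by blast
    have 0: "A\<^sup>T *\<^sub>v 0\<^sub>v r1 = 0\<^sub>v m1" "B\<^sup>T *\<^sub>v 0\<^sub>v r1 + D\<^sup>T *\<^sub>v d = D\<^sup>T *\<^sub>v d"
      unfolding transpose_mult_zero_vec[OF assms(1)] transpose_mult_zero_vec[OF assms(2)] using D[of d] by simp_all
    let ?v = "A\<^sup>T *\<^sub>v 0\<^sub>v r1 @\<^sub>v (B\<^sup>T *\<^sub>v 0\<^sub>v r1 + D\<^sup>T *\<^sub>v d)"
    have "coords ?v \<in> coords ` rowsp (m1 + m2) (block_ut2 A B D)"
      unfolding coords_rowsp_block_ut2[OF assms(1-3)] using d(1) zero_carrier_vec[of r1] by blast
    moreover have "coords ?v \<in> tail_space (m1 + m2) m1"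
      unfolding 0 using D by (rule coords_zero_append)
    moreover have "f = shift m1 (coords ?v)"
      unfolding d(2) shift_coords_append[OF A] 0(2) ..
    ultimately show "f \<in> shift m1 ` (coords ` rowsp (m1 + m2) (block_ut2 A B D) \<inter> tail_space (m1 + m2) m1)"
      by blast
  }
qed

lemma row_independent_block_ut2:
  assumes A: "A \<in> carrier_mat r1 m1" and B: "B \<in> carrier_mat r1 m2" and D: "D \<in> carrier_mat r2 m2"
    and "row_independent A" "row_independent D"
  shows "row_independent (block_ut2 A B (D :: 'a::field mat))"
  unfolding row_independent_def
proof (intro ballI impI)
  let ?M = "block_ut2 A B D"
  have M: "?M \<in> carrier_mat (r1 + r2) (m1 + m2)" using A B D by (rule block_ut2_carrier)
  fix c assume c: "c \<in> carrier_vec (dim_row ?M)" "?M\<^sup>T *\<^sub>v c = 0\<^sub>v (dim_col ?M)"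
  then have "c \<in> carrier_vec (r1 + r2)" using M by simp
  then obtain a d where ad: "c = a @\<^sub>v d" "a \<in> carrier_vec r1" "d \<in> carrier_vec r2"
    unfolding carrier_vec_append by blast
  have "A\<^sup>T *\<^sub>v a @\<^sub>v (B\<^sup>T *\<^sub>v a + D\<^sup>T *\<^sub>v d) = 0\<^sub>v m1 @\<^sub>v 0\<^sub>v m2"
    using c(2) carrier_matD(2)[OF M] unfolding ad(1) block_ut2_row_combination[OF A B D ad(2,3)]
    by (simp only: zero_vec_append)
  then have eqs: "A\<^sup>T *\<^sub>v a = 0\<^sub>v m1" "B\<^sup>T *\<^sub>v a + D\<^sup>T *\<^sub>v d = 0\<^sub>v m2"
    using append_vec_eq[OF transpose_mult_vec_carrier[OF A] zero_carrier_vec] by simp_all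
  have "dim_row A = r1" "dim_col A = m1" "dim_row D = r2" "dim_col D = m2" using A D by auto
  note indep = assms(4,5)[unfolded row_independent_def this]
  have a: "a = 0\<^sub>v r1" using indep(1) eqs(1) ad(2) by blast
  have "D\<^sup>T *\<^sub>v d = 0\<^sub>v m2"
    using eqs(2) transpose_mult_vec_carrier[OF D, of d] unfolding a transpose_mult_zero_vec[OF B] by simp
  then have "d = 0\<^sub>v r2" using indep(2) ad(3) by blast
  with a show "c = 0\<^sub>v (dim_row ?M)" using carrier_matD(1)[OF M] ad(1) by (simp only: zero_vec_append)
qed

lemma row_independent_id_zero_mat:
  assumes "r \<le> m"
  shows "row_independent (id_zero_mat r m :: 'a::field mat)"
  unfolding row_independent_def
proof (intro ballI impI)
  let ?I = "id_zero_mat r m :: 'a mat"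
  fix a assume a: "a \<in> carrier_vec (dim_row ?I)" "?I\<^sup>T *\<^sub>v a = 0\<^sub>v (dim_col ?I)"
  show "a = 0\<^sub>v (dim_row ?I)"
  proof (rule eq_vecI)
    fix i assume i: "i < dim_vec (0\<^sub>v (dim_row ?I) :: 'a vec)"
    then have ir: "i < r" "i < m" using assms by (auto simp: id_zero_mat_def)
    have "0 = (?I\<^sup>T *\<^sub>v a) $ i" using a(2) ir by (simp add: id_zero_mat_def)
    also have "\<dots> = (\<Sum>k<r. (if k = i then 1 else 0) * a $ k)"
      using a(1) ir by (simp add: id_zero_mat_def scalar_prod_def atLeast0LessThan)
    also have "\<dots> = a $ i" using ir by (simp add: if_distrib[of "\<lambda>x. x * _"] cong: if_cong)
    finally show "a $ i = 0\<^sub>v (dim_row ?I) $ i" using i by simp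
  qed (use a in simp)
qed

text \<open>By counting, the vectors of the row space that vanish in the first block are exactly the
  combinations of the lower rows.\<close>

lemma row_independent_upper_block:
  fixes A :: "'a::{field,finite} mat"
  assumes A: "A \<in> carrier_mat r1 m1" and B: "B \<in> carrier_mat r1 m2" and D: "D \<in> carrier_mat r2 m2"
    and full: "card (rowsp (m1 + m2) (block_ut2 A B D)) = CARD('a) ^ (r1 + r2)"
    and tail: "card (coords ` rowsp (m1 + m2) (block_ut2 A B D) \<inter> tail_space (m1 + m2) m1) = CARD('a) ^ r2"
  shows "row_independent A"
proof -
  let ?M = "block_ut2 A B D"
  have M: "?M \<in> carrier_mat (r1 + r2) (m1 + m2)" using A B D by (rule block_ut2_carrier)
  have "inj_on (\<lambda>c. ?M\<^sup>T *\<^sub>v c) (carrier_vec (r1 + r2))"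
    using full unfolding rowsp_eq[OF M]
    by (intro eq_card_imp_inj_on) (simp_all add: finite_carrier_vec card_carrier_vec)
  moreover have "inj_on coords ((\<lambda>c. ?M\<^sup>T *\<^sub>v c) ` carrier_vec (r1 + r2))"
    using M by (intro inj_on_subset[OF inj_on_coords[of "m1 + m2"]]) auto
  ultimately have inj: "inj_on (\<lambda>c. coords (?M\<^sup>T *\<^sub>v c)) (carrier_vec (r1 + r2))"
    using comp_inj_on[of "\<lambda>c. ?M\<^sup>T *\<^sub>v c" _ coords] by (simp add: comp_def)
  define g where "g d = coords (?M\<^sup>T *\<^sub>v (0\<^sub>v r1 @\<^sub>v d))" for d
  let ?Z = "coords ` rowsp (m1 + m2) ?M \<inter> tail_space (m1 + m2) m1"
  have row: "coords (?M\<^sup>T *\<^sub>v (a @\<^sub>v d)) \<in> ?Z"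
    if a: "a \<in> carrier_vec r1" "A\<^sup>T *\<^sub>v a = 0\<^sub>v m1" and d: "d \<in> carrier_vec r2" for a d
  proof
    show "coords (?M\<^sup>T *\<^sub>v (a @\<^sub>v d)) \<in> coords ` rowsp (m1 + m2) ?M"
      unfolding rowsp_eq[OF M] using a(1) d by (intro imageI) simp
    show "coords (?M\<^sup>T *\<^sub>v (a @\<^sub>v d)) \<in> tail_space (m1 + m2) m1"
      unfolding block_ut2_row_combination[OF A B D a(1) d] a(2)
      by (intro coords_zero_append add_carrier_vec transpose_mult_vec_carrier[OF B] transpose_mult_vec_carrier[OF D])
  qed
  have "g ` carrier_vec r2 = ?Z"
  proof (rule card_subset_eq)
    show "finite ?Z" using finite_tail_space by blast
    show "g ` carrier_vec r2 \<subseteq> ?Z"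
      unfolding g_def using transpose_mult_zero_vec[OF A] by (intro image_subsetI row) auto
    have "inj_on g (carrier_vec r2)"
    proof (rule inj_onI)
      fix d d' :: "'a vec" assume d: "d \<in> carrier_vec r2" "d' \<in> carrier_vec r2" "g d = g d'"
      have "0\<^sub>v r1 @\<^sub>v d = 0\<^sub>v r1 @\<^sub>v d'"
        using d by (intro inj_onD[OF inj]) (simp_all add: g_def)
      then show "d = d'" using append_vec_eq[OF zero_carrier_vec zero_carrier_vec] by blast
    qed
    then show "card (g ` carrier_vec r2) = card ?Z"
      using tail by (simp add: card_image card_carrier_vec)
  qed
  \<comment> \<open>For a relation \<open>a\<close> among the rows of \<open>A\<close>, the
    combination with coefficients (a, 0) vanishes in the first block, so it equals one with
    coefficients (0, d). Injectivity then compares the coefficients.\<close>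
  moreover have "a = 0\<^sub>v r1" if a: "a \<in> carrier_vec r1" "A\<^sup>T *\<^sub>v a = 0\<^sub>v m1" and eq: "g ` carrier_vec r2 = ?Z" for a
  proof -
    have "coords (?M\<^sup>T *\<^sub>v (a @\<^sub>v 0\<^sub>v r2)) \<in> g ` carrier_vec r2"
      unfolding eq using a by (intro row) auto
    then obtain d where d: "d \<in> carrier_vec r2" "coords (?M\<^sup>T *\<^sub>v (a @\<^sub>v 0\<^sub>v r2)) = g d" by auto
    have "a @\<^sub>v 0\<^sub>v r2 = 0\<^sub>v r1 @\<^sub>v d"
      using a d by (intro inj_onD[OF inj]) (simp_all add: g_def)
    then show "a = 0\<^sub>v r1" using append_vec_eq[OF a(1) zero_carrier_vec] by blast
  qed
  moreover have "dim_row A = r1" "dim_col A = m1" using A by auto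
  ultimately show ?thesis unfolding row_independent_def by simp
qed

section \<open>Embedded flags and the blocks of a subspace\<close>

interpretation fun_space: flagged_space "\<lambda>(c :: 'a::field) (f :: nat \<Rightarrow> 'a) i. c * f i"
  by unfold_locales (auto simp: fun_eq_iff algebra_simps)

text \<open>The numbers \<open>m1\<close> and \<open>m2\<close> count the leading coordinates that
  vanish on E2 and on E3; in the application they are \<open>n1\<close> and
  \<open>n1 + n2\<close>.\<close>

definition flag_system :: "nat \<Rightarrow> nat \<Rightarrow> nat \<Rightarrow> (nat \<Rightarrow> 'a::zero) set \<Rightarrow> (nat \<Rightarrow> 'a) set \<Rightarrow> node \<Rightarrow> (nat \<Rightarrow> 'a) set"
  where "flag_system n m1 m2 X Y k =
    (case k of NV \<Rightarrow> tail_space n 0 | NE2 \<Rightarrow> tail_space n m1 | NE3 \<Rightarrow> tail_space n m2 | NU \<Rightarrow> X | NQ \<Rightarrow> Y)"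

lemma flag_system_simps [simp]:
  "flag_system n m1 m2 X Y NV = tail_space n 0" "flag_system n m1 m2 X Y NE2 = tail_space n m1"
  "flag_system n m1 m2 X Y NE3 = tail_space n m2" "flag_system n m1 m2 X Y NU = X"
  "flag_system n m1 m2 X Y NQ = Y"
  by (simp_all add: flag_system_def)

lemma subspace_tail_space: "fun_space.subspace (tail_space n m :: (nat \<Rightarrow> 'a::field) set)"
  by (auto simp: fun_space.subspace_def tail_space_def)

lemma subspace_coords_image:
  fixes W :: "'a::field vec set"
  assumes "is_subspace n W"
  shows "fun_space.subspace (coords ` W)"
proof -
  have W: "W \<subseteq> carrier_vec n" "0\<^sub>v n \<in> W" "\<And>v w. v \<in> W \<Longrightarrow> w \<in> W \<Longrightarrow> v + w \<in> W" "\<And>c v. v \<in> W \<Longrightarrow> c \<cdot>\<^sub>v v \<in> W"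
    using assms unfolding is_subspace_iff by blast+
  show ?thesis
    unfolding fun_space.subspace_def
  proof (intro conjI ballI allI)
    have "coords (0\<^sub>v n :: 'a vec) = 0" by (rule ext) (simp add: coords_def)
    then show "0 \<in> coords ` W" using W(2) by (intro image_eqI[of _ _ "0\<^sub>v n"]) simp_all
  next
    fix x y assume "x \<in> coords ` W" "y \<in> coords ` W"
    then obtain v w where vw: "v \<in> W" "w \<in> W" "x = coords v" "y = coords w" by blast
    then have "v \<in> carrier_vec n" "w \<in> carrier_vec n" using W(1) by auto
    then have "x + y = coords (v + w)" using vw(3,4) by (simp add: coords_add)
    then show "x + y \<in> coords ` W" using W(3)[OF vw(1,2)] by (rule image_eqI)
  next
    fix c x assume "x \<in> coords ` W"
    then obtain v where v: "v \<in> W" "x = coords v" by blast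
    have "(\<lambda>i. c * x i) = coords (c \<cdot>\<^sub>v v)" by (simp add: v(2) coords_smult)
    then show "(\<lambda>i. c * x i) \<in> coords ` W" using W(4)[OF v(1)] by (rule image_eqI)
  qed
qed

lemma flagged_pair_flag_system:
  fixes U W :: "'a::{field,finite} vec set"
  assumes U: "is_subspace n U" and W: "is_subspace n W" and "m1 \<le> m2"
  shows "fun_space.flagged_pair (flag_system n m1 m2 (coords ` U) (coords ` W))"
proof -
  have sub: "coords ` U \<subseteq> tail_space n 0" "coords ` W \<subseteq> tail_space n 0"
    using U W unfolding is_subspace_iff coords_image_carrier[symmetric] by (auto intro: imageI)
  have tail: "tail_space n m \<subseteq> (tail_space n 0 :: (nat \<Rightarrow> 'a) set)" for m
    by (auto simp: tail_space_def)
  have "fun_space.subspace (flag_system n m1 m2 (coords ` U) (coords ` W) k) \<and>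
      flag_system n m1 m2 (coords ` U) (coords ` W) k \<subseteq> tail_space n 0" for k
    using sub tail subspace_tail_space subspace_coords_image[OF U] subspace_coords_image[OF W]
    by (cases k) simp_all
  moreover have "tail_space n m2 \<subseteq> (tail_space n m1 :: (nat \<Rightarrow> 'a) set)"
    using \<open>m1 \<le> m2\<close> by (auto simp: tail_space_def)
  ultimately show ?thesis
    by (simp add: fun_space.flagged_pair_def finite_tail_space)
qed

text \<open>The \<open>R\<close>'s are the row spaces of the diagonal blocks, of the upper left and of the lower right
  \<open>2 \<times> 2\<close> block matrix of a block upper triangular matrix with row space \<open>X\<close>.\<close>

definition block_images ::
  "nat \<Rightarrow> nat \<Rightarrow> nat \<Rightarrow> (nat \<Rightarrow> 'a::field) set \<Rightarrow> 'a vec set \<Rightarrow> 'a vec set \<Rightarrow> 'a vec set \<Rightarrow> 'a vec set \<Rightarrow> 'a vec set \<Rightarrow> bool"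
  where "block_images n1 n2 n3 X R1 R2 R3 R12 R23 \<longleftrightarrow>
    R1 \<subseteq> carrier_vec n1 \<and> R2 \<subseteq> carrier_vec n2 \<and> R3 \<subseteq> carrier_vec n3 \<and>
    R12 \<subseteq> carrier_vec (n1 + n2) \<and> R23 \<subseteq> carrier_vec (n2 + n3) \<and> X \<subseteq> tail_space (n1 + n2 + n3) 0 \<and>
    trunc n1 ` X = coords ` R1 \<and> trunc (n1 + n2) ` X = coords ` R12 \<and>
    shift n1 ` trunc (n1 + n2) ` (X \<inter> tail_space (n1 + n2 + n3) n1) = coords ` R2 \<and>
    shift n1 ` (X \<inter> tail_space (n1 + n2 + n3) n1) = coords ` R23 \<and>
    shift (n1 + n2) ` (X \<inter> tail_space (n1 + n2 + n3) (n1 + n2)) = coords ` R3"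

lemma rowsp_subset_carrier: "A \<in> carrier_mat r n \<Longrightarrow> rowsp n A \<subseteq> carrier_vec n" for A :: "'a::field mat"
  using is_subspace_rowsp[of A r n] unfolding is_subspace_iff by blast

lemma block_ut3_carrier:
  assumes "A \<in> carrier_mat r1 n1" "B \<in> carrier_mat r1 n2" "C \<in> carrier_mat r1 n3"
    "D \<in> carrier_mat r2 n2" "E \<in> carrier_mat r2 n3" "F \<in> carrier_mat r3 n3"
  shows "block_ut3 A B C D E F \<in> carrier_mat (r1 + r2 + r3) (n1 + n2 + n3)"
  unfolding block_ut3_def
  by (intro block_ut2_carrier[where ?r1.0 = "r1 + r2"] block_ut2_carrier carrier_append_rows assms)

text \<open>Split after the second block, the matrix yields the upper left 2 by 2 block by
  truncation and the last diagonal block by shifting; split after the first, it yields the first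
  diagonal block and the lower right 2 by 2 block. The middle block is a truncation of the latter,
  because \<open>shift\<close> and \<open>trunc\<close> commute up to renumbering.\<close>

lemma block_images_block_ut3:
  fixes A :: "'a::field mat"
  assumes A: "A \<in> carrier_mat r1 n1" and B: "B \<in> carrier_mat r1 n2" and C: "C \<in> carrier_mat r1 n3"
    and D: "D \<in> carrier_mat r2 n2" and E: "E \<in> carrier_mat r2 n3" and F: "F \<in> carrier_mat r3 n3"
    and indep: "row_independent A" "row_independent (block_ut2 A B D)"
  shows "block_images n1 n2 n3 (coords ` rowsp (n1 + n2 + n3) (block_ut3 A B C D E F))
    (rowsp n1 A) (rowsp n2 D) (rowsp n3 F) (rowsp (n1 + n2) (block_ut2 A B D))
    (rowsp (n2 + n3) (block_ut2 D E F))"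
proof -
  let ?X = "coords ` rowsp (n1 + n2 + n3) (block_ut3 A B C D E F)"
  let ?BC = "four_block_mat B C (0\<^sub>m 0 n2) (0\<^sub>m 0 n3)"
  have AD: "block_ut2 A B D \<in> carrier_mat (r1 + r2) (n1 + n2)" using A B D by (rule block_ut2_carrier)
  have DF: "block_ut2 D E F \<in> carrier_mat (r2 + r3) (n2 + n3)" using D E F by (rule block_ut2_carrier)
  have CE: "C @\<^sub>r E \<in> carrier_mat (r1 + r2) n3" using C E by (rule carrier_append_rows)
  have BC: "?BC \<in> carrier_mat r1 (n2 + n3)" using B C by auto
  have X12: "?X = coords ` rowsp ((n1 + n2) + n3) (block_ut2 (block_ut2 A B D) (C @\<^sub>r E) F)"
    by (simp add: block_ut3_def)
  have X23: "?X = coords ` rowsp (n1 + (n2 + n3)) (block_ut2 A ?BC (block_ut2 D E F))"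
    by (simp add: block_ut3_assoc[OF A B C D E F] add.assoc)
  have n: "n1 + n2 + n3 = n1 + (n2 + n3)" by simp
  have "trunc n1 ` ?X = coords ` rowsp n1 A"
    unfolding X23 by (rule trunc_rowsp_block_ut2[OF A BC DF])
  moreover have "trunc (n1 + n2) ` ?X = coords ` rowsp (n1 + n2) (block_ut2 A B D)"
    unfolding X12 by (rule trunc_rowsp_block_ut2[OF AD CE F])
  moreover have 23: "shift n1 ` (?X \<inter> tail_space (n1 + n2 + n3) n1) = coords ` rowsp (n2 + n3) (block_ut2 D E F)"
    unfolding X23 unfolding n by (rule shift_rowsp_block_ut2[OF A BC DF indep(1)])
  moreover have "shift n1 ` trunc (n1 + n2) ` (?X \<inter> tail_space (n1 + n2 + n3) n1) = coords ` rowsp n2 D"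
  proof -
    have "shift n1 ` trunc (n1 + n2) ` (?X \<inter> tail_space (n1 + n2 + n3) n1) =
      trunc n2 ` shift n1 ` (?X \<inter> tail_space (n1 + n2 + n3) n1)"
      unfolding image_image shift_trunc ..
    then show ?thesis unfolding 23 trunc_rowsp_block_ut2[OF D E F] .
  qed
  moreover have "shift (n1 + n2) ` (?X \<inter> tail_space (n1 + n2 + n3) (n1 + n2)) = coords ` rowsp n3 F"
    unfolding X12 by (rule shift_rowsp_block_ut2[OF AD CE F indep(2)])
  moreover have "?X \<subseteq> tail_space (n1 + n2 + n3) 0"
    unfolding coords_image_carrier[symmetric]
    by (intro image_mono rowsp_subset_carrier[OF block_ut3_carrier[OF A B C D E F]])
  ultimately show ?thesis
    unfolding block_images_def
    by (intro conjI rowsp_subset_carrier[OF A] rowsp_subset_carrier[OF D] rowsp_subset_carrier[OF F]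
        rowsp_subset_carrier[OF AD] rowsp_subset_carrier[OF DF])
qed

lemma card_inter_shift:
  assumes "X \<subseteq> {f. \<forall>i<m. f i = 0}" "Y \<subseteq> {f. \<forall>i<m. f i = 0}"
    and "shift m ` X = coords ` R" "shift m ` Y = coords ` S" "R \<subseteq> carrier_vec k" "S \<subseteq> carrier_vec k"
  shows "card (X \<inter> Y) = card (R \<inter> S)"
proof -
  have "card (X \<inter> Y) = card (shift m ` (X \<inter> Y))"
    using assms(1) by (intro card_image[symmetric] inj_on_subset[OF inj_on_shift[of m]]) auto
  also have "shift m ` (X \<inter> Y) = coords ` (R \<inter> S)"
    using assms(3,4) coords_image_Int[OF assms(5,6)] inj_on_image_Int[OF inj_on_shift assms(1,2)] by simp
  also have "card \<dots> = card (R \<inter> S)" using assms(5) by (intro card_coords_image[of _ k]) auto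
  finally show ?thesis .
qed

lemma block_imagesD:
  assumes "block_images n1 n2 n3 X R1 R2 R3 R12 R23"
  shows "R1 \<subseteq> carrier_vec n1" "R2 \<subseteq> carrier_vec n2" "R3 \<subseteq> carrier_vec n3"
    "R12 \<subseteq> carrier_vec (n1 + n2)" "R23 \<subseteq> carrier_vec (n2 + n3)" "X \<subseteq> tail_space (n1 + n2 + n3) 0"
    "trunc n1 ` X = coords ` R1" "trunc (n1 + n2) ` X = coords ` R12"
    "shift n1 ` trunc (n1 + n2) ` (X \<inter> tail_space (n1 + n2 + n3) n1) = coords ` R2"
    "shift n1 ` (X \<inter> tail_space (n1 + n2 + n3) n1) = coords ` R23"
    "shift (n1 + n2) ` (X \<inter> tail_space (n1 + n2 + n3) (n1 + n2)) = coords ` R3"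
  using assms unfolding block_images_def by simp_all

text \<open>Truncation passes to V/E2 and V/E3, and within E2 to E2/E3, so by
  \<open>card_meet_tail_space\<close> each meet of sums counts a block intersection times the flag
  member divided out. Intersections inside E2 and E3 are carried bijectively to block intersections
  by \<open>shift\<close>.\<close>

lemma block_images_cards:
  fixes X Y :: "(nat \<Rightarrow> 'a::{field,finite}) set"
  assumes X: "block_images n1 n2 n3 X R1 R2 R3 R12 R23" and Y: "block_images n1 n2 n3 Y S1 S2 S3 S12 S23"
  defines "n \<equiv> n1 + n2 + n3"
  shows "card (leval (flag_system n n1 (n1 + n2) X Y) meet12) =
      card (R1 \<inter> S1) * card (tail_space n n1 :: (nat \<Rightarrow> 'a) set)"
    and "card (leval (flag_system n n1 (n1 + n2) X Y) meet13) =
      card (R12 \<inter> S12) * card (tail_space n (n1 + n2) :: (nat \<Rightarrow> 'a) set)"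
    and "card (leval (flag_system n n1 (n1 + n2) X Y) meet23) =
      card (R2 \<inter> S2) * card (tail_space n (n1 + n2) :: (nat \<Rightarrow> 'a) set)"
    and "card (X \<inter> Y \<inter> tail_space n n1) = card (R23 \<inter> S23)"
    and "card (X \<inter> Y \<inter> tail_space n (n1 + n2)) = card (R3 \<inter> S3)"
proof -
  note X' = block_imagesD[OF X, folded n_def] and Y' = block_imagesD[OF Y, folded n_def]
  have le: "n1 \<le> n" "n1 + n2 \<le> n" by (simp_all add: n_def)
  have coords_card: "card (coords ` R \<inter> coords ` S) = card (R \<inter> S)"
    if "R \<subseteq> carrier_vec k" "S \<subseteq> carrier_vec k" for R S :: "'a vec set" and k
    unfolding coords_image_Int[OF that, symmetric] using that by (intro card_coords_image[of _ k]) auto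
  show "card (leval (flag_system n n1 (n1 + n2) X Y) meet12) =
      card (R1 \<inter> S1) * card (tail_space n n1 :: (nat \<Rightarrow> 'a) set)"
    unfolding meet12_def leval.simps flag_system_simps card_meet_tail_space[OF X'(6) Y'(6) le(1)]
      X'(7) Y'(7) coords_card[OF X'(1) Y'(1)] ..
  show "card (leval (flag_system n n1 (n1 + n2) X Y) meet13) =
      card (R12 \<inter> S12) * card (tail_space n (n1 + n2) :: (nat \<Rightarrow> 'a) set)"
    unfolding meet13_def leval.simps flag_system_simps card_meet_tail_space[OF X'(6) Y'(6) le(2)]
      X'(8) Y'(8) coords_card[OF X'(4) Y'(4)] ..
  have tail: "A \<inter> tail_space n m \<subseteq> {f. \<forall>i<m. f i = 0}"
    "A \<inter> tail_space n m \<subseteq> tail_space n 0" for A :: "(nat \<Rightarrow> 'a) set" and m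
    by (auto simp: tail_space_def)
  have trunc_tail: "trunc (n1 + n2) ` (A \<inter> tail_space n n1) \<subseteq> {f. \<forall>i<n1. f i = 0}"
    for A :: "(nat \<Rightarrow> 'a) set"
    by (auto simp: tail_space_def trunc_def)
  show "card (leval (flag_system n n1 (n1 + n2) X Y) meet23) =
      card (R2 \<inter> S2) * card (tail_space n (n1 + n2) :: (nat \<Rightarrow> 'a) set)"
    unfolding meet23_def leval.simps flag_system_simps card_meet_tail_space[OF tail(2) tail(2) le(2)]
      card_inter_shift[OF trunc_tail trunc_tail X'(9) Y'(9) X'(2) Y'(2)] ..
  have inter: "X \<inter> Y \<inter> tail_space n m = (X \<inter> tail_space n m) \<inter> (Y \<inter> tail_space n m)" for m by blast
  show "card (X \<inter> Y \<inter> tail_space n n1) = card (R23 \<inter> S23)"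
    unfolding inter by (rule card_inter_shift[OF tail(1) tail(1) X'(10) Y'(10) X'(5) Y'(5)])
  show "card (X \<inter> Y \<inter> tail_space n (n1 + n2)) = card (R3 \<inter> S3)"
    unfolding inter by (rule card_inter_shift[OF tail(1) tail(1) X'(11) Y'(11) X'(3) Y'(3)])
qed

text \<open>The flag and \<open>X\<close> are shared, and the three cardinality assumptions cover
  \<open>Y\<close> and \<open>Z\<close>, so nine invariants agree from the start. In the three meets
  of sums the common nonzero factor cancels.\<close>

lemma block_images_invariants_iff:
  fixes X Y Z :: "(nat \<Rightarrow> 'a::{field,finite}) set"
  assumes X: "block_images n1 n2 n3 X R1 R2 R3 R12 R23" and Y: "block_images n1 n2 n3 Y S1 S2 S3 S12 S23"
    and Z: "block_images n1 n2 n3 Z T1 T2 T3 T12 T23"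
  defines "n \<equiv> n1 + n2 + n3"
  assumes "card Y = card Z" "card (Y \<inter> tail_space n n1) = card (Z \<inter> tail_space n n1)"
    "card (Y \<inter> tail_space n (n1 + n2)) = card (Z \<inter> tail_space n (n1 + n2))"
  shows "(\<forall>t\<in>invariant_terms. card (leval (flag_system n n1 (n1 + n2) X Y) t) =
      card (leval (flag_system n n1 (n1 + n2) X Z) t)) \<longleftrightarrow>
    card (R1 \<inter> S1) = card (R1 \<inter> T1) \<and> card (R2 \<inter> S2) = card (R2 \<inter> T2) \<and> card (R3 \<inter> S3) = card (R3 \<inter> T3) \<and>
    card (X \<inter> Y) = card (X \<inter> Z) \<and> card (R12 \<inter> S12) = card (R12 \<inter> T12) \<and> card (R23 \<inter> S23) = card (R23 \<inter> T23)"
proof -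
  have pos: "card (tail_space n m :: (nat \<Rightarrow> 'a) set) \<noteq> 0" for m
  proof -
    have "(0 :: nat \<Rightarrow> 'a) \<in> tail_space n m" by (simp add: tail_space_def)
    then show ?thesis using finite_tail_space[of n m] by (auto simp: card_eq_0_iff)
  qed
  note cards = block_images_cards[OF X Y, folded n_def] block_images_cards[OF X Z, folded n_def]
  have "(\<forall>t\<in>invariant_terms. card (leval (flag_system n n1 (n1 + n2) X Y) t) =
      card (leval (flag_system n n1 (n1 + n2) X Z) t)) \<longleftrightarrow>
    card (X \<inter> Y) = card (X \<inter> Z) \<and>
    card (X \<inter> Y \<inter> tail_space n n1) = card (X \<inter> Z \<inter> tail_space n n1) \<and>
    card (X \<inter> Y \<inter> tail_space n (n1 + n2)) = card (X \<inter> Z \<inter> tail_space n (n1 + n2)) \<and>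
    card (leval (flag_system n n1 (n1 + n2) X Y) meet12) = card (leval (flag_system n n1 (n1 + n2) X Z) meet12) \<and>
    card (leval (flag_system n n1 (n1 + n2) X Y) meet13) = card (leval (flag_system n n1 (n1 + n2) X Z) meet13) \<and>
    card (leval (flag_system n n1 (n1 + n2) X Y) meet23) = card (leval (flag_system n n1 (n1 + n2) X Z) meet23)"
    using assms(5-7) by (simp add: invariant_terms_def)
  then show ?thesis
    by (simp only: cards mult_cancel2 pos simp_thms) (intro iffI conjI; elim conjE; assumption)
qed

section \<open>Orbits and linear maps\<close>

lemma GL3_carrier_mat: "T \<in> carrier (GL3 n1 n2 n3) \<Longrightarrow> T \<in> carrier_mat (n1 + n2 + n3) (n1 + n2 + n3)"
  unfolding GL3_def by (auto simp: block_ut3_carrier)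

text \<open>Row \<open>i\<close> of \<open>T\<close> is the image of the unit vector with index
  \<open>i\<close>. The vanishing entries thus say that unit vectors in E2 or E3 have images in the
  same flag member, which is the form comparable with linear maps.\<close>

lemma GL3_mem_iff:
  "T \<in> carrier (GL3 n1 n2 n3) \<longleftrightarrow> T \<in> carrier_mat (n1 + n2 + n3) (n1 + n2 + n3) \<and> invertible_mat T \<and>
    (\<forall>i<n1 + n2 + n3. \<forall>j<n1 + n2 + n3. (n1 \<le> i \<and> j < n1) \<or> (n1 + n2 \<le> i \<and> j < n1 + n2) \<longrightarrow>
      T $$ (i, j) = (0 :: 'a::field))"
  (is "_ \<longleftrightarrow> ?carr \<and> _ \<and> ?zero")
proof
  assume T: "T \<in> carrier (GL3 n1 n2 n3)"
  have "?zero"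
  proof (intro allI impI)
    fix i j assume "i < n1 + n2 + n3" "j < n1 + n2 + n3" "(n1 \<le> i \<and> j < n1) \<or> (n1 + n2 \<le> i \<and> j < n1 + n2)"
    with T show "T $$ (i, j) = 0"
      unfolding GL3_def
      by (elim disjE) (auto simp: block_ut3_def block_ut2_def append_rows_def)
  qed
  with T GL3_carrier_mat[OF T] show "?carr \<and> invertible_mat T \<and> ?zero" by (simp add: GL3_def)
next
  assume T: "?carr \<and> invertible_mat T \<and> ?zero"
  let ?B = "\<lambda>r k r' k'. mat r k (\<lambda>(i, j). T $$ (i + r', j + k'))"
  have eq: "T = block_ut3 (?B n1 n1 0 0) (?B n1 n2 0 n1) (?B n1 n3 0 (n1 + n2))
      (?B n2 n2 n1 n1) (?B n2 n3 n1 (n1 + n2)) (?B n3 n3 (n1 + n2) (n1 + n2))" (is "T = ?M")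
  proof (rule eq_matI)
    show dim: "dim_row T = dim_row ?M" "dim_col T = dim_col ?M"
      using T[THEN conjunct1] by (simp_all add: block_ut3_def block_ut2_def append_rows_def)
    fix i j assume "i < dim_row ?M" "j < dim_col ?M"
    then have ij: "i < n1 + n2 + n3" "j < n1 + n2 + n3"
      by (simp_all add: block_ut3_def block_ut2_def append_rows_def)
    then show "T $$ (i, j) = ?M $$ (i, j)"
      using T by (simp add: block_ut3_def block_ut2_def append_rows_def)
  qed
  with T show "T \<in> carrier (GL3 n1 n2 n3)"
    unfolding GL3_def
    by (simp only: partial_object.simps mem_Collect_eq)
      (intro conjI bexI, simp, rule eq, simp_all only: mat_carrier)
qed

lemma invertible_mat_iff_inj:
  fixes T :: "'a::field mat"
  assumes T: "T \<in> carrier_mat n n"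
  shows "invertible_mat T \<longleftrightarrow> (\<forall>v\<in>carrier_vec n. T\<^sup>T *\<^sub>v v = 0\<^sub>v n \<longrightarrow> v = 0\<^sub>v n)"
proof
  assume "invertible_mat T"
  then obtain B where B: "T * B = 1\<^sub>m n" "B * T = 1\<^sub>m (dim_row B)"
    using T by (auto simp: invertible_mat_def inverts_mat_def)
  have "dim_col (T * B) = n" "dim_col (B * T) = dim_row B" using B by simp_all
  then have Bc: "B \<in> carrier_mat n n" using T by auto
  show "\<forall>v\<in>carrier_vec n. T\<^sup>T *\<^sub>v v = 0\<^sub>v n \<longrightarrow> v = 0\<^sub>v n"
  proof (intro ballI impI)
    fix v :: "'a vec" assume v: "v \<in> carrier_vec n" "T\<^sup>T *\<^sub>v v = 0\<^sub>v n"
    have "v = (T * B)\<^sup>T *\<^sub>v v" using v(1) B(1) by simp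
    also have "\<dots> = B\<^sup>T *\<^sub>v (T\<^sup>T *\<^sub>v v)"
      unfolding transpose_mult[OF T Bc] using T Bc v(1) by (intro assoc_mult_mat_vec) auto
    also have "\<dots> = 0\<^sub>v n" unfolding v(2) by (rule transpose_mult_zero_vec[OF Bc])
    finally show "v = 0\<^sub>v n" .
  qed
next
  assume inj: "\<forall>v\<in>carrier_vec n. T\<^sup>T *\<^sub>v v = 0\<^sub>v n \<longrightarrow> v = 0\<^sub>v n"
  have "det T\<^sup>T \<noteq> 0"
    using inj det_0_iff_vec_prod_zero_field[of "T\<^sup>T" n] T by auto
  then have "det T \<noteq> 0" using det_transpose[OF T] by simp
  \<comment> \<open>\<open>undefined\<close> instantiates the free record extension of the ring of
    matrices.\<close>
  from det_non_zero_imp_unit[OF T this, of undefined]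
  obtain B where "B * T = 1\<^sub>m n" "T * B = 1\<^sub>m n" "B \<in> carrier_mat n n"
    by (auto simp: Units_def ring_mat_simps)
  then show "invertible_mat T"
    using T by (auto simp: invertible_mat_def inverts_mat_def)
qed

lemma right_act_coords:
  assumes "\<And>v. v \<in> carrier_vec n \<Longrightarrow> coords (T\<^sup>T *\<^sub>v v) = f (coords v)" "W \<subseteq> carrier_vec n"
  shows "coords ` right_act T W = f ` coords ` W"
proof -
  have "coords ` right_act T W = (\<lambda>w. coords (T\<^sup>T *\<^sub>v w)) ` W"
    by (simp add: right_act_def image_image)
  also have "\<dots> = (\<lambda>w. f (coords w)) ` W"
    using assms by (intro image_cong) auto
  finally show ?thesis by (simp add: image_image)
qed

lemma right_act_eq_iff:
  assumes T: "T \<in> carrier_mat n n" and f: "\<And>v. v \<in> carrier_vec n \<Longrightarrow> coords (T\<^sup>T *\<^sub>v v) = f (coords v)"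
    and W: "W \<subseteq> carrier_vec n" "W' \<subseteq> carrier_vec n"
  shows "right_act T W = W' \<longleftrightarrow> f ` coords ` W = coords ` W'"
proof -
  have "right_act T W \<subseteq> carrier_vec n"
    unfolding right_act_def using transpose_mult_vec_carrier[OF T] by blast
  then show ?thesis
    using inj_on_image_eq_iff[OF inj_on_coords _ W(2)] right_act_coords[OF f W(1)] by metis
qed

text \<open>Induction on the number of coordinates kept, with \<open>g\<close> equal to its
  truncation at \<open>n\<close>. Additivity controls finite sums only, hence the bounded
  support.\<close>

lemma linear_fun_expand:
  fixes f :: "(nat \<Rightarrow> 'a::field) \<Rightarrow> nat \<Rightarrow> 'a"
  assumes add: "\<And>x y. f (x + y) = f x + f y" and scale: "\<And>c x. f (\<lambda>i. c * x i) = (\<lambda>i. c * f x i)"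
    and g: "g \<in> tail_space n 0"
  shows "f g j = (\<Sum>i<n. g i * f (\<lambda>k. if k = i then 1 else 0) j)"
proof -
  have "f (trunc m g) j = (\<Sum>i<m. g i * f (\<lambda>k. if k = i then 1 else 0) j)" for m
  proof (induction m)
    case 0
    have f0: "f 0 = 0" using add[of 0 0] by simp
    have "trunc 0 g = 0" by (rule ext) (simp add: trunc_def)
    then show ?case by (subst \<open>trunc 0 g = 0\<close>, subst f0) simp
  next
    case (Suc m)
    have eq: "trunc (Suc m) g = trunc m g + (\<lambda>k. g m * (if k = m then 1 else 0))"
      by (rule ext) (auto simp: trunc_def less_Suc_eq)
    show ?case
      by (subst eq, subst add, subst scale) (simp add: Suc)
  qed
  moreover have "trunc n g = g" using g by (intro ext) (simp add: trunc_def tail_space_def)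
  ultimately show ?thesis by metis
qed

lemma orbit_stabilizer_GL3_iff:
  "P \<in> orbit (stabilizer_GL3 n1 n2 n3 U) right_act Q \<longleftrightarrow>
    (\<exists>T\<in>carrier (GL3 n1 n2 n3). right_act T U = U \<and> right_act T Q = P)"
  by (auto simp: orbit_def stabilizer_GL3_def stabilizer_def)

text \<open>A matrix acts on embedded vectors as a linear map, and a linear map preserving V has a
  matrix whose rows are its values at unit sequences. Block triangularity corresponds to preserving
  E2 and E3. Invertibility of the matrix comes from the map being onto the finite space V.\<close>

lemma orbit_iff_linear:
  fixes U Q P :: "'a::{field,finite} vec set" and n1 n2 n3 :: nat
  defines "n \<equiv> n1 + n2 + n3"
  assumes U: "U \<subseteq> carrier_vec n" and Q: "Q \<subseteq> carrier_vec n" and P: "P \<subseteq> carrier_vec n"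
  shows "P \<in> orbit (stabilizer_GL3 n1 n2 n3 U) right_act Q \<longleftrightarrow>
    (\<exists>f. (\<forall>x y. f (x + y) = f x + f y) \<and> (\<forall>c x. f (\<lambda>i. c * x i) = (\<lambda>i. c * f x i)) \<and>
      (\<forall>k. f ` flag_system n n1 (n1 + n2) (coords ` U) (coords ` Q) k =
        flag_system n n1 (n1 + n2) (coords ` U) (coords ` P) k))"
proof
  assume "P \<in> orbit (stabilizer_GL3 n1 n2 n3 U) right_act Q"
  then obtain T where TG: "T \<in> carrier (GL3 n1 n2 n3)" and TU: "right_act T U = U" and TQ: "right_act T Q = P"
    unfolding orbit_stabilizer_GL3_iff by (elim bexE conjE)
  note GL3_T = TG[unfolded GL3_mem_iff, folded n_def]
  have T: "T \<in> carrier_mat n n" and inv: "invertible_mat T" using GL3_T by simp_all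
  note zero = GL3_T[THEN conjunct2, THEN conjunct2, rule_format]
  \<comment> \<open>Sequences are first cut to length \<open>n\<close>, which makes \<open>f\<close>
    linear on the whole type.\<close>
  define f where "f g = coords (T\<^sup>T *\<^sub>v vec n g)" for g
  have TT: "T\<^sup>T \<in> carrier_mat n n" using T by simp
  have f_coords: "coords (T\<^sup>T *\<^sub>v v) = f (coords v)" if "v \<in> carrier_vec n" for v
  proof -
    have "vec n (coords v) = v" using that by (intro eq_vecI) (auto simp: coords_def)
    then show ?thesis by (simp add: f_def)
  qed
  have add: "f (x + y) = f x + f y" for x y
  proof -
    have "vec n (x + y) = vec n x + vec n y" by (intro eq_vecI) auto
    then show ?thesis
      unfolding f_def
      by (simp only: mult_add_distrib_mat_vec[OF TT] vec_carrier
          coords_add[OF transpose_mult_vec_carrier[OF T] transpose_mult_vec_carrier[OF T]])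
  qed
  have scale: "f (\<lambda>i. c * x i) = (\<lambda>i. c * f x i)" for c x
  proof -
    have "vec n (\<lambda>i. c * x i) = c \<cdot>\<^sub>v vec n x" by (intro eq_vecI) auto
    then show ?thesis by (simp add: f_def mult_mat_vec[OF TT] coords_smult)
  qed
  have inj: "inj_on f (tail_space n 0)"
  proof (rule inj_onI)
    fix x y assume xy: "x \<in> tail_space n 0" "y \<in> tail_space n 0" "f x = f y"
    have "f (x - y) + f y = f x" using add[of "x - y" y] by simp
    with xy(3) have "f (x - y) = 0" by simp
    then have "coords (T\<^sup>T *\<^sub>v vec n (x - y)) = coords (0\<^sub>v n)"
      by (intro ext) (simp add: f_def coords_def)
    then have "T\<^sup>T *\<^sub>v vec n (x - y) = 0\<^sub>v n"
      by (rule inj_onD[OF inj_on_coords[of n]]) (simp_all add: transpose_mult_vec_carrier[OF T])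
    then have 0: "vec n (x - y) = 0\<^sub>v n"
      by (rule inv[unfolded invertible_mat_iff_inj[OF T], rule_format, OF vec_carrier])
    show "x = y"
    proof
      fix i
      show "x i = y i"
      proof (cases "i < n")
        case True
        then have "vec n (x - y) $ i = 0" unfolding 0 by simp
        with True show ?thesis by simp
      qed (use xy in \<open>simp add: tail_space_def\<close>)
    qed
  qed
  \<comment> \<open>The zero pattern of \<open>T\<close> gives only that the image is contained in
    the tail space; an injective self-map of a finite set is onto.\<close>
  have tail: "f ` tail_space n m = tail_space n m" if m: "m = 0 \<or> m = n1 \<or> m = n1 + n2" for m
  proof (rule endo_inj_surj[OF finite_tail_space])
    show "inj_on f (tail_space n m)"
      by (rule inj_on_subset[OF inj]) (auto simp: tail_space_def)
    show "f ` tail_space n m \<subseteq> tail_space n m"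
    proof (rule image_subsetI)
      fix g :: "nat \<Rightarrow> 'a" assume g: "g \<in> tail_space n m"
      have "(T\<^sup>T *\<^sub>v vec n g) $ j = 0" if j: "j < m" "j < n" for j
      proof -
        have "(T\<^sup>T *\<^sub>v vec n g) $ j = (\<Sum>i<n. T $$ (i, j) * g i)"
          using T j by (simp add: scalar_prod_def atLeast0LessThan)
        also have "\<dots> = 0"
        proof (rule sum.neutral, rule ballI)
          fix i assume i: "i \<in> {..<n}"
          show "T $$ (i, j) * g i = 0"
          proof (cases "i < m")
            case True
            then show ?thesis using g by (simp add: tail_space_def)
          next
            case False
            have "T $$ (i, j) = 0"
            proof (rule zero)
              show "n1 \<le> i \<and> j < n1 \<or> n1 + n2 \<le> i \<and> j < n1 + n2" using m j(1) False by auto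
            qed (use i j(2) in simp_all)
            then show ?thesis by simp
          qed
        qed
        finally show ?thesis .
      qed
      then show "f g \<in> tail_space n m"
        unfolding f_def coords_in_tail_space[OF transpose_mult_vec_carrier[OF T]] by simp
    qed
  qed
  have imgs: "f ` coords ` U = coords ` U" "f ` coords ` Q = coords ` P"
    using right_act_coords[OF f_coords U] right_act_coords[OF f_coords Q] TU TQ by simp_all
  have "f ` flag_system n n1 (n1 + n2) (coords ` U) (coords ` Q) k =
      flag_system n n1 (n1 + n2) (coords ` U) (coords ` P) k" for k
    by (cases k) (simp_all add: imgs tail)
  with add scale show "\<exists>f. (\<forall>x y. f (x + y) = f x + f y) \<and> (\<forall>c x. f (\<lambda>i. c * x i) = (\<lambda>i. c * f x i)) \<and>
      (\<forall>k. f ` flag_system n n1 (n1 + n2) (coords ` U) (coords ` Q) k =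
        flag_system n n1 (n1 + n2) (coords ` U) (coords ` P) k)"
    by (intro exI[of _ f]) simp
next
  assume "\<exists>f. (\<forall>x y. f (x + y) = f x + f y) \<and> (\<forall>c x. f (\<lambda>i. c * x i) = (\<lambda>i. c * f x i)) \<and>
      (\<forall>k. f ` flag_system n n1 (n1 + n2) (coords ` U) (coords ` Q) k =
        flag_system n n1 (n1 + n2) (coords ` U) (coords ` P) k)"
  then obtain f :: "(nat \<Rightarrow> 'a) \<Rightarrow> nat \<Rightarrow> 'a"
    where all: "(\<forall>x y. f (x + y) = f x + f y) \<and> (\<forall>c x. f (\<lambda>i. c * x i) = (\<lambda>i. c * f x i)) \<and>
      (\<forall>k. f ` flag_system n n1 (n1 + n2) (coords ` U) (coords ` Q) k =
        flag_system n n1 (n1 + n2) (coords ` U) (coords ` P) k)" ..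
  then have add: "f (x + y) = f x + f y" and scale: "f (\<lambda>i. c * x i) = (\<lambda>i. c * f x i)" for x y c
    using all[THEN conjunct1] all[THEN conjunct2, THEN conjunct1] by simp_all
  have img: "f ` flag_system n n1 (n1 + n2) (coords ` U) (coords ` Q) k =
        flag_system n n1 (n1 + n2) (coords ` U) (coords ` P) k" for k
    using all[THEN conjunct2, THEN conjunct2] by (rule spec)
  have tail: "f ` tail_space n 0 = tail_space n 0" "f ` tail_space n n1 = tail_space n n1"
    "f ` tail_space n (n1 + n2) = tail_space n (n1 + n2)"
    and UQ: "f ` coords ` U = coords ` U" "f ` coords ` Q = coords ` P"
    using img[of NV] img[of NE2] img[of NE3] img[of NU] img[of NQ] by simp_all
  define e where "e i = (\<lambda>k. if k = i then 1 else 0 :: 'a)" for i :: nat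
  define T where "T = mat n n (\<lambda>(i, j). f (e i) j)"
  have T: "T \<in> carrier_mat n n" by (simp add: T_def)
  have f_tail: "f g \<in> tail_space n m" if "g \<in> tail_space n m" "m = 0 \<or> m = n1 \<or> m = n1 + n2" for g m
    using that tail by blast
  have f_coords: "coords (T\<^sup>T *\<^sub>v v) = f (coords v)" if v: "v \<in> carrier_vec n" for v
  proof
    fix j
    have cv: "coords v \<in> tail_space n 0" using v by (auto simp: coords_in_tail_space)
    show "coords (T\<^sup>T *\<^sub>v v) j = f (coords v) j"
    proof (cases "j < n")
      case True
      have "coords (T\<^sup>T *\<^sub>v v) j = (\<Sum>i<n. f (e i) j * v $ i)"
        using True v by (simp add: coords_def T_def scalar_prod_def atLeast0LessThan)
      also have "\<dots> = (\<Sum>i<n. coords v i * f (e i) j)"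
        using v by (intro sum.cong) (simp_all add: coords_def mult.commute)
      also have "\<dots> = f (coords v) j"
        using linear_fun_expand[of f "coords v" n j, OF add scale cv] by (simp add: e_def)
      finally show ?thesis .
    next
      case False
      then have "f (coords v) j = 0" using f_tail[OF cv] by (simp add: tail_space_def)
      with False T show ?thesis by (simp add: coords_def)
    qed
  qed
  have inj: "inj_on f (tail_space n 0)"
    by (rule eq_card_imp_inj_on[OF finite_tail_space]) (simp add: tail(1))
  have "invertible_mat T"
    unfolding invertible_mat_iff_inj[OF T]
  proof (intro ballI impI)
    fix v :: "'a vec" assume v: "v \<in> carrier_vec n" "T\<^sup>T *\<^sub>v v = 0\<^sub>v n"
    have z: "coords (0\<^sub>v n :: 'a vec) = 0" by (rule ext) (simp add: coords_def)
    have f0: "f 0 = 0" using add[of 0 0] by simp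
    have "f (coords v) = f 0" using f_coords[OF v(1)] v(2) z f0 by simp
    moreover have "coords v \<in> tail_space n 0" "0 \<in> (tail_space n 0 :: (nat \<Rightarrow> 'a) set)"
      using v(1) by (simp_all add: coords_in_tail_space) (simp add: tail_space_def)
    ultimately have "coords v = 0" by (rule inj_onD[OF inj])
    then have "coords v = coords (0\<^sub>v n)" unfolding z .
    then show "v = 0\<^sub>v n"
      by (rule inj_onD[OF inj_on_coords[of n]]) (simp_all add: v(1))
  qed
  moreover have "T $$ (i, j) = 0"
    if ij: "i < n" "j < n" "(n1 \<le> i \<and> j < n1) \<or> (n1 + n2 \<le> i \<and> j < n1 + n2)" for i j
  proof -
    obtain m where m: "m = n1 \<or> m = n1 + n2" "m \<le> i" "j < m" using ij(3) by blast
    then have "e i \<in> tail_space n m" using ij(1) by (auto simp: e_def tail_space_def)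
    from f_tail[OF this] m have "f (e i) j = 0" by (auto simp: tail_space_def)
    with ij show ?thesis by (simp add: T_def)
  qed
  ultimately have "T \<in> carrier (GL3 n1 n2 n3)"
    using T unfolding GL3_mem_iff n_def[symmetric] by simp
  moreover have "right_act T U = U" "right_act T Q = P"
    using right_act_eq_iff[OF T f_coords U U] right_act_eq_iff[OF T f_coords Q P] UQ by simp_all
  ultimately show "P \<in> orbit (stabilizer_GL3 n1 n2 n3 U) right_act Q"
    unfolding orbit_stabilizer_GL3_iff by (intro bexI conjI)
qed

section \<open>From the type of a subspace to its blocks\<close>

lemma subspaces_of_type_cards:
  fixes W :: "'a::{field,finite} vec set" and n1 n2 n3 :: nat
  defines "n \<equiv> n1 + n2 + n3"
  assumes W: "W \<in> subspaces_of_type k1 k2 k3 n1 n2 n3"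
  shows "is_subspace n W" "card W = CARD('a) ^ k1"
    "card (coords ` W \<inter> tail_space n n1) = CARD('a) ^ k2"
    "card (coords ` W \<inter> tail_space n (n1 + n2)) = CARD('a) ^ k3"
proof -
  have dims: "is_subspace n W" "subspace_dim n W = k1"
    "subspace_dim n (W \<inter> last_coords n (n2 + n3)) = k2" "subspace_dim n (W \<inter> last_coords n n3) = k3"
    using W by (simp_all add: subspaces_of_type_def Let_def n_def)
  show sub: "is_subspace n W" by (rule dims(1))
  show "card W = CARD('a) ^ k1"
    using card_subspace_dim[OF sub] dims(2) by simp
  have inter: "card (coords ` W \<inter> tail_space n m) = CARD('a) ^ subspace_dim n (W \<inter> last_coords n d)"
    if md: "m + d = n" for m d
  proof -
    let ?E = "{v \<in> carrier_vec n. \<forall>i<m. v $ i = (0 :: 'a)}"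
    have m: "m \<le> n" using md by simp
    have E: "is_subspace n (W \<inter> ?E)"
      by (rule is_subspace_inter[OF sub is_subspace_vanish[OF m]])
    have WE: "W \<subseteq> carrier_vec n" "?E \<subseteq> carrier_vec n"
      using sub unfolding is_subspace_iff by auto
    have "coords ` W \<inter> tail_space n m = coords ` (W \<inter> ?E)"
      unfolding coords_image_Int[OF WE] coords_image_tail_space[OF m] ..
    then have "card (coords ` W \<inter> tail_space n m) = card (W \<inter> ?E)"
      using WE card_coords_image[of "W \<inter> ?E" n] by auto
    then show ?thesis
      unfolding last_coords_eq[OF md] card_subspace_dim[OF E] .
  qed
  show "card (coords ` W \<inter> tail_space n n1) = CARD('a) ^ k2"
    using inter[of n1 "n2 + n3"] dims(3) by (simp add: n_def)
  show "card (coords ` W \<inter> tail_space n (n1 + n2)) = CARD('a) ^ k3"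
    using inter[of "n1 + n2" n3] dims(4) by (simp add: n_def)
qed

text \<open>The type says that the row space has as many dimensions as there are rows, and that its
  parts in E2 and E3 have as many as the corresponding lower rows. Through
  \<open>row_independent_upper_block\<close>, applied to both groupings of the blocks, this gives
  full row rank of the upper blocks.\<close>

lemma block_images_of_type:
  fixes A B C D E F :: "'a::{field,finite} mat"
  assumes A: "A \<in> carrier_mat r1 n1" and B: "B \<in> carrier_mat r1 n2" and C: "C \<in> carrier_mat r1 n3"
    and D: "D \<in> carrier_mat r2 n2" and E: "E \<in> carrier_mat r2 n3" and F: "F \<in> carrier_mat r3 n3"
    and type: "rowsp (n1 + n2 + n3) (block_ut3 A B C D E F) \<in>
      subspaces_of_type (r1 + r2 + r3) (r2 + r3) r3 n1 n2 n3"
  shows "block_images n1 n2 n3 (coords ` rowsp (n1 + n2 + n3) (block_ut3 A B C D E F))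
    (rowsp n1 A) (rowsp n2 D) (rowsp n3 F) (rowsp (n1 + n2) (block_ut2 A B D))
    (rowsp (n2 + n3) (block_ut2 D E F))"
proof (rule block_images_block_ut3[OF A B C D E F])
  note cards = subspaces_of_type_cards[OF type]
  have AD: "block_ut2 A B D \<in> carrier_mat (r1 + r2) (n1 + n2)" using A B D by (rule block_ut2_carrier)
  have DF: "block_ut2 D E F \<in> carrier_mat (r2 + r3) (n2 + n3)" using D E F by (rule block_ut2_carrier)
  have CE: "C @\<^sub>r E \<in> carrier_mat (r1 + r2) n3" using C E by (rule carrier_append_rows)
  have BC: "four_block_mat B C (0\<^sub>m 0 n2) (0\<^sub>m 0 n3) \<in> carrier_mat r1 (n2 + n3)" using B C by auto
  show "row_independent A"
    by (rule row_independent_upper_block[OF A BC DF])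
      (use cards(2,3) in \<open>simp_all add: block_ut3_assoc[OF A B C D E F] add.assoc\<close>)
  show "row_independent (block_ut2 A B D)"
    by (rule row_independent_upper_block[OF AD CE F])
      (use cards(2,4) in \<open>simp_all add: block_ut3_def\<close>)
qed

text \<open>For \<open>U\<close> the independence of the diagonal blocks is known directly, and
  \<open>row_independent_block_ut2\<close> passes it on to the upper left 2 by 2 block, so no
  dimension count enters.\<close>

lemma block_images_block_diag3:
  fixes A :: "'a::field mat"
  assumes A: "A \<in> carrier_mat r1 n1" and D: "D \<in> carrier_mat r2 n2" and F: "F \<in> carrier_mat r3 n3"
    and "row_independent A" "row_independent D"
  shows "block_images n1 n2 n3 (coords ` rowsp (n1 + n2 + n3) (block_diag3 A D F))
    (rowsp n1 A) (rowsp n2 D) (rowsp n3 F) (rowsp (n1 + n2) (block_diag2 A D))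
    (rowsp (n2 + n3) (block_diag2 D F))"
    "block_diag3 A D F \<in> carrier_mat (r1 + r2 + r3) (n1 + n2 + n3)"
    "block_diag2 A D \<in> carrier_mat (r1 + r2) (n1 + n2)"
    "block_diag2 D F \<in> carrier_mat (r2 + r3) (n2 + n3)"
proof -
  have AD: "block_diag2 A D = block_ut2 A (0\<^sub>m r1 n2) D" and DF: "block_diag2 D F = block_ut2 D (0\<^sub>m r2 n3) F"
    using A D F by (simp_all add: block_diag2_def)
  have zero: "0\<^sub>m (r1 + r2) n3 = (0\<^sub>m r1 n3 :: 'a mat) @\<^sub>r 0\<^sub>m r2 n3"
    by (intro eq_matI) (auto simp: append_rows_def)
  have ADF: "block_diag3 A D F = block_ut3 A (0\<^sub>m r1 n2) (0\<^sub>m r1 n3) D (0\<^sub>m r2 n3) F"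
    using A D F unfolding block_diag3_def block_ut3_def zero[symmetric]
    by (simp add: block_diag2_def block_ut2_def)
  show AD': "block_diag2 A D \<in> carrier_mat (r1 + r2) (n1 + n2)"
    unfolding AD using A D by (intro block_ut2_carrier) auto
  show "block_diag2 D F \<in> carrier_mat (r2 + r3) (n2 + n3)"
    unfolding DF using D F by (intro block_ut2_carrier) auto
  show "block_diag3 A D F \<in> carrier_mat (r1 + r2 + r3) (n1 + n2 + n3)"
    unfolding ADF using A D F by (intro block_ut3_carrier) auto
  show "block_images n1 n2 n3 (coords ` rowsp (n1 + n2 + n3) (block_diag3 A D F))
    (rowsp n1 A) (rowsp n2 D) (rowsp n3 F) (rowsp (n1 + n2) (block_diag2 A D))
    (rowsp (n2 + n3) (block_diag2 D F))"
    unfolding ADF AD DF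
    by (rule block_images_block_ut3[OF A _ _ D _ F assms(4) row_independent_block_ut2[OF A _ D assms(4,5)]])
      simp_all
qed

theorem theorem3p1:
  fixes n1 n2 n3 k1 k2 k3 n :: nat
    and U11 U22 U33 U :: "'a::{field,finite} mat"
    and Q11 Q12 Q13 Q22 Q23 Q33 P11 P12 P13 P22 P23 P33 :: "'a mat"
    and Q P :: "'a vec set"
  assumes n: "n = n1 + n2 + n3"
    and k3: "k3 \<le> n3"
    and k2: "k3 \<le> k2" "k2 - k3 \<le> n2"
    and k1: "k2 \<le> k1" "k1 - k2 \<le> n1"
    and U11: "U11 = id_zero_mat (k1 - k2) n1"
    and U22: "U22 = id_zero_mat (k2 - k3) n2"
    and U33: "U33 = id_zero_mat k3 n3"
    and U: "U = block_diag3 U11 U22 U33"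
    and Q_blocks:
      "Q11 \<in> carrier_mat (k1 - k2) n1" "Q12 \<in> carrier_mat (k1 - k2) n2"
      "Q13 \<in> carrier_mat (k1 - k2) n3" "Q22 \<in> carrier_mat (k2 - k3) n2"
      "Q23 \<in> carrier_mat (k2 - k3) n3" "Q33 \<in> carrier_mat k3 n3"
    and P_blocks:
      "P11 \<in> carrier_mat (k1 - k2) n1" "P12 \<in> carrier_mat (k1 - k2) n2"
      "P13 \<in> carrier_mat (k1 - k2) n3" "P22 \<in> carrier_mat (k2 - k3) n2"
      "P23 \<in> carrier_mat (k2 - k3) n3" "P33 \<in> carrier_mat k3 n3"
    and Q: "Q \<in> subspaces_of_type k1 k2 k3 n1 n2 n3"
      "Q = rowsp n (block_ut3 Q11 Q12 Q13 Q22 Q23 Q33)"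
    and P: "P \<in> subspaces_of_type k1 k2 k3 n1 n2 n3"
      "P = rowsp n (block_ut3 P11 P12 P13 P22 P23 P33)"
  shows "P \<in> orbit (stabilizer_GL3 n1 n2 n3 (rowsp n U)) right_act Q \<longleftrightarrow>
    subspace_dim n1 (rowsp n1 U11 \<inter> rowsp n1 Q11) =
      subspace_dim n1 (rowsp n1 U11 \<inter> rowsp n1 P11) \<and>
    subspace_dim n2 (rowsp n2 U22 \<inter> rowsp n2 Q22) =
      subspace_dim n2 (rowsp n2 U22 \<inter> rowsp n2 P22) \<and>
    subspace_dim n3 (rowsp n3 U33 \<inter> rowsp n3 Q33) =
      subspace_dim n3 (rowsp n3 U33 \<inter> rowsp n3 P33) \<and>
    subspace_dim n (rowsp n U \<inter> Q) = subspace_dim n (rowsp n U \<inter> P) \<and>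
    subspace_dim (n1 + n2)
        (rowsp (n1 + n2) (block_diag2 U11 U22) \<inter>
         rowsp (n1 + n2) (block_ut2 Q11 Q12 Q22)) =
      subspace_dim (n1 + n2)
        (rowsp (n1 + n2) (block_diag2 U11 U22) \<inter>
         rowsp (n1 + n2) (block_ut2 P11 P12 P22)) \<and>
    subspace_dim (n2 + n3)
        (rowsp (n2 + n3) (block_diag2 U22 U33) \<inter>
         rowsp (n2 + n3) (block_ut2 Q22 Q23 Q33)) =
      subspace_dim (n2 + n3)
        (rowsp (n2 + n3) (block_diag2 U22 U33) \<inter>
         rowsp (n2 + n3) (block_ut2 P22 P23 P33))"
proof -
  \<comment> \<open>Named block sizes replace truncated subtraction, so that \<open>k1\<close> and
    \<open>k2\<close> become sums as in \<open>block_images_of_type\<close>.\<close>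
  define r1 r2 where "r1 = k1 - k2" and "r2 = k2 - k3"
  have r: "k1 - k2 = r1" "k2 - k3 = r2" "r2 + k3 = k2" "r1 + r2 + k3 = k1" "r1 \<le> n1" "r2 \<le> n2"
    using k1 k2 by (simp_all add: r1_def r2_def)
  note Qb = Q_blocks[unfolded r] and Pb = P_blocks[unfolded r]
  have Uc: "U11 \<in> carrier_mat r1 n1" "U22 \<in> carrier_mat r2 n2" "U33 \<in> carrier_mat k3 n3"
    by (simp_all add: U11 U22 U33 r id_zero_mat_def)
  have Uind: "row_independent U11" "row_independent U22"
    unfolding U11 U22 r using r by (simp_all add: row_independent_id_zero_mat)
  note Ubl = block_images_block_diag3[OF Uc Uind, folded U, folded n]
  note Qc = subspaces_of_type_cards[OF Q(1), folded n] and Pc = subspaces_of_type_cards[OF P(1), folded n]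
  have Qim: "block_images n1 n2 n3 (coords ` Q) (rowsp n1 Q11) (rowsp n2 Q22) (rowsp n3 Q33)
      (rowsp (n1 + n2) (block_ut2 Q11 Q12 Q22)) (rowsp (n2 + n3) (block_ut2 Q22 Q23 Q33))"
    using block_images_of_type[OF Qb] Q by (simp add: n r)
  have Pim: "block_images n1 n2 n3 (coords ` P) (rowsp n1 P11) (rowsp n2 P22) (rowsp n3 P33)
      (rowsp (n1 + n2) (block_ut2 P11 P12 P22)) (rowsp (n2 + n3) (block_ut2 P22 P23 P33))"
    using block_images_of_type[OF Pb] P by (simp add: n r)
  have Usub: "is_subspace n (rowsp n U)" by (rule is_subspace_rowsp[OF Ubl(2)])
  have carr: "rowsp n U \<subseteq> carrier_vec n" "Q \<subseteq> carrier_vec n" "P \<subseteq> carrier_vec n"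
    using Usub Qc(1) Pc(1) by (simp_all add: is_subspace_iff)
  let ?S = "\<lambda>W. flag_system n n1 (n1 + n2) (coords ` rowsp n U) (coords ` W)"
  have "P \<in> orbit (stabilizer_GL3 n1 n2 n3 (rowsp n U)) right_act Q \<longleftrightarrow>
      (\<forall>t\<in>invariant_terms. card (leval (?S Q) t) = card (leval (?S P) t))"
    unfolding orbit_iff_linear[OF carr[unfolded n], folded n]
    by (intro fun_space.flagged_pair_iso_iff flagged_pair_flag_system Usub Qc(1) Pc(1)) simp_all
  also have "\<dots> \<longleftrightarrow>
    card (rowsp n1 U11 \<inter> rowsp n1 Q11) = card (rowsp n1 U11 \<inter> rowsp n1 P11) \<and>
    card (rowsp n2 U22 \<inter> rowsp n2 Q22) = card (rowsp n2 U22 \<inter> rowsp n2 P22) \<and>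
    card (rowsp n3 U33 \<inter> rowsp n3 Q33) = card (rowsp n3 U33 \<inter> rowsp n3 P33) \<and>
    card (coords ` rowsp n U \<inter> coords ` Q) = card (coords ` rowsp n U \<inter> coords ` P) \<and>
    card (rowsp (n1 + n2) (block_diag2 U11 U22) \<inter> rowsp (n1 + n2) (block_ut2 Q11 Q12 Q22)) =
      card (rowsp (n1 + n2) (block_diag2 U11 U22) \<inter> rowsp (n1 + n2) (block_ut2 P11 P12 P22)) \<and>
    card (rowsp (n2 + n3) (block_diag2 U22 U33) \<inter> rowsp (n2 + n3) (block_ut2 Q22 Q23 Q33)) =
      card (rowsp (n2 + n3) (block_diag2 U22 U33) \<inter> rowsp (n2 + n3) (block_ut2 P22 P23 P33))"
    unfolding n
  proof (rule block_images_invariants_iff[OF Ubl(1)[unfolded n] Qim Pim])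
    show "card (coords ` Q) = card (coords ` P)"
      using Qc(2) Pc(2) by (simp add: card_coords_image[OF carr(2)] card_coords_image[OF carr(3)])
  qed (use Qc(3,4) Pc(3,4) in \<open>simp_all add: n\<close>)
  also have "card (coords ` rowsp n U \<inter> coords ` Q) = card (rowsp n U \<inter> Q)"
    unfolding coords_image_Int[OF carr(1,2), symmetric] using carr by (intro card_coords_image[of _ n]) auto
  also have "card (coords ` rowsp n U \<inter> coords ` P) = card (rowsp n U \<inter> P)"
    unfolding coords_image_Int[OF carr(1,3), symmetric] using carr by (intro card_coords_image[of _ n]) auto
  finally have orbit_iff: "P \<in> orbit (stabilizer_GL3 n1 n2 n3 (rowsp n U)) right_act Q \<longleftrightarrow>
    card (rowsp n1 U11 \<inter> rowsp n1 Q11) = card (rowsp n1 U11 \<inter> rowsp n1 P11) \<and>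
    card (rowsp n2 U22 \<inter> rowsp n2 Q22) = card (rowsp n2 U22 \<inter> rowsp n2 P22) \<and>
    card (rowsp n3 U33 \<inter> rowsp n3 Q33) = card (rowsp n3 U33 \<inter> rowsp n3 P33) \<and>
    card (rowsp n U \<inter> Q) = card (rowsp n U \<inter> P) \<and>
    card (rowsp (n1 + n2) (block_diag2 U11 U22) \<inter> rowsp (n1 + n2) (block_ut2 Q11 Q12 Q22)) =
      card (rowsp (n1 + n2) (block_diag2 U11 U22) \<inter> rowsp (n1 + n2) (block_ut2 P11 P12 P22)) \<and>
    card (rowsp (n2 + n3) (block_diag2 U22 U33) \<inter> rowsp (n2 + n3) (block_ut2 Q22 Q23 Q33)) =
      card (rowsp (n2 + n3) (block_diag2 U22 U33) \<inter> rowsp (n2 + n3) (block_ut2 P22 P23 P33))" .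
  have dim_iff: "subspace_dim m (rowsp m A \<inter> rowsp m B) = subspace_dim m (rowsp m A \<inter> rowsp m C) \<longleftrightarrow>
      card (rowsp m A \<inter> rowsp m B) = card (rowsp m A \<inter> rowsp m C)"
    if "A \<in> carrier_mat a m" "B \<in> carrier_mat b m" "C \<in> carrier_mat b m" for A B C :: "'a mat" and m a b
    by (intro subspace_dim_eq_iff is_subspace_inter is_subspace_rowsp[OF that(1)]
        is_subspace_rowsp[OF that(2)] is_subspace_rowsp[OF that(3)])
  have "subspace_dim n (rowsp n U \<inter> Q) = subspace_dim n (rowsp n U \<inter> P) \<longleftrightarrow>
      card (rowsp n U \<inter> Q) = card (rowsp n U \<inter> P)"
    by (intro subspace_dim_eq_iff is_subspace_inter Usub Qc(1) Pc(1))
  then show ?thesis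
    unfolding orbit_iff dim_iff[OF Uc(1) Qb(1) Pb(1)] dim_iff[OF Uc(2) Qb(4) Pb(4)] dim_iff[OF Uc(3) Qb(6) Pb(6)]
      dim_iff[OF Ubl(3) block_ut2_carrier[OF Qb(1,2,4)] block_ut2_carrier[OF Pb(1,2,4)]]
      dim_iff[OF Ubl(4) block_ut2_carrier[OF Qb(4,5,6)] block_ut2_carrier[OF Pb(4,5,6)]]
    by simp
qed

end
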